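(* Let $f\in\mathcal N_u$ (so $\sigma_u(f)\le 0$) with $f\not\equiv 0$. Then $$\|f\|_0=\log(1+|f(+\infty)|)+\lim_{\sigma_0\to0^+}\lim_{T\to\infty}\frac1{2T}\int_{\sigma_0}^{\infty}\int_{-T}^{T}\frac{|f'(\sigma+it)|^2}{|f(\sigma+it)|\,(1+|f(\sigma+it)|)^2}\,(\sigma-\sigma_0)\,dt\,d\sigma .$$
   Context: For $\theta\in\mathbb R$ put $\mathbb C_\theta=\{s\in\mathbb C:\operatorname{Re}s>\theta\}$. A Dirichlet series is a series $f(s)=\sum_{n\ge1}a_nn^{-s}$; its abscissa of uniform convergence $\sigma_u(f)\in[-\infty,+\infty]$ is the infimum of all $\theta\in\mathbb R$ such that the series converges uniformly on $\mathbb C_\theta$. The Nevanlinna class of Dirichlet series $\mathcal N_u$ consists of all Dirichlet series $f$ with $\sigma_u(f)\le0$ and $\limsup_{\sigma\to0^+}\lim_{T\to\infty}\frac1{2T}\int_{-T}^T\log^+|f(\sigma+it)|\,dt<\infty$, where $\log^+x=\max\{\log x,0\}$; such $f$ are holomorphic on $\mathbb C_0$. For $f\in\mathcal N_u$, $\|f\|_0=\limsup_{\sigma\to0^+}\lim_{T\to\infty}\frac1{2T}\int_{-T}^T\log(1+|f(\sigma+it)|)\,dt$. Finally, $f(+\infty)=a_1=\lim_{\operatorname{Re}s\to+\infty}f(s)$. The integrand is understood off the discrete zero set of $f$. *)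

theory Defs
  imports "HOL-Analysis.Analysis"
begin

text \<open>
  A Dirichlet series is given by its coefficient sequence \<open>a\<close>, of which only the
  entries \<open>a 1, a 2, \<dots>\<close> are used; \<open>a 0\<close> is irrelevant throughout.
\<close>

definition half_plane :: "real \<Rightarrow> complex set" where
  "half_plane \<theta> = {s. Re s > \<theta>}"

definition dirichlet_partial_sum :: "(nat \<Rightarrow> complex) \<Rightarrow> nat \<Rightarrow> complex \<Rightarrow> complex" where
  "dirichlet_partial_sum a N s = (\<Sum>n=1..N. a n * of_nat n powr (- s))"

text \<open>Only meaningful at points of convergence, in particular on \<open>half_plane 0\<close> if
  the abscissa of uniform convergence is at most \<open>0\<close>.\<close>

definition dirichlet_fun :: "(nat \<Rightarrow> complex) \<Rightarrow> complex \<Rightarrow> complex" where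
  "dirichlet_fun a s = (\<Sum>n. a (Suc n) * of_nat (Suc n) powr (- s))"

definition abscissa_unif :: "(nat \<Rightarrow> complex) \<Rightarrow> ereal" where
  "abscissa_unif a =
     Inf {ereal \<theta> |\<theta>. uniformly_convergent_on (half_plane \<theta>) (dirichlet_partial_sum a)}"

text \<open>The value at \<open>0\<close> is \<open>0\<close>, because \<open>ln 0 = 0\<close>; this agrees with
  the usual convention \<open>log 0 = -\<infinity>\<close>.\<close>

definition log_plus :: "real \<Rightarrow> real" where
  "log_plus x = max (ln x) 0"

text \<open>Below, the mean is taken of continuous functions \<open>t \<mapsto> \<phi> \<bar>f (\<sigma> + i t)\<bar>\<close>
  with \<open>\<sigma> > 0\<close>. These are uniformly almost periodic when the series converges
  uniformly on every \<open>half_plane \<theta>\<close> with \<open>\<theta> > 0\<close>, so the limit exists.\<close>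

definition mean_value :: "(real \<Rightarrow> real) \<Rightarrow> real" where
  "mean_value h = Lim at_top (\<lambda>T. 1 / (2 * T) * integral {-T..T} h)"

definition nevanlinna_class :: "(nat \<Rightarrow> complex) set" where
  "nevanlinna_class = {a. abscissa_unif a \<le> 0 \<and>
     Limsup (at_right 0) (\<lambda>\<sigma>. ereal (mean_value
       (\<lambda>t. log_plus (norm (dirichlet_fun a (Complex \<sigma> t)))))) < \<infinity>}"

definition nevanlinna_norm :: "(nat \<Rightarrow> complex) \<Rightarrow> ereal" where
  "nevanlinna_norm a =
     Limsup (at_right 0) (\<lambda>\<sigma>. ereal (mean_value
       (\<lambda>t. ln (1 + norm (dirichlet_fun a (Complex \<sigma> t))))))"

text \<open>At a zero of \<open>f\<close> the quotient is \<open>0\<close> by the convention \<open>x / 0 = 0\<close>;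
  for \<open>f\<close> not identically zero this only concerns a discrete subset of
  \<open>half_plane 0\<close>.\<close>

definition lp_density :: "(complex \<Rightarrow> complex) \<Rightarrow> complex \<Rightarrow> real" where
  "lp_density f s = (norm (deriv f s))\<^sup>2 / (norm (f s) * (1 + norm (f s))\<^sup>2)"

text \<open>The inner integral is \<open>\<infinity>\<close> when \<open>\<sigma>\<close> is the real part of a simple zero
  with imaginary part in \<open>[-T, T]\<close>. There are only countably many such
  \<open>\<sigma>\<close>, so they do not affect the outer integral.\<close>

definition lp_integral :: "(complex \<Rightarrow> complex) \<Rightarrow> real \<Rightarrow> real \<Rightarrow> ennreal" where
  "lp_integral f \<sigma>\<^sub>0 T =
     (\<integral>\<^sup>+\<sigma>\<in>{\<sigma>\<^sub>0<..}. (\<integral>\<^sup>+t\<in>{-T..T}.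
        ennreal (lp_density f (Complex \<sigma> t) * (\<sigma> - \<sigma>\<^sub>0)) \<partial>lborel) \<partial>lborel)"

end

theory Submission
  imports Defs "HOL-Complex_Analysis.Complex_Analysis"
begin

text \<open>
  The function \<open>w = ln (1 + \<bar>f\<bar>)\<close> has Laplacian \<open>lp_density f\<close>: computing with
  \<open>\<bar>f\<bar>\<close> as variable gives \<open>\<bar>f'\<bar>\<^sup>2 (1 / (\<bar>f\<bar> (1 + \<bar>f\<bar>)) - 1 / (1 + \<bar>f\<bar>)\<^sup>2)\<close> off the zeros,
  and the zeros contribute no point masses because \<open>w\<close> is bounded there. Green's formula on
  a rectangle \<open>[\<alpha>, \<beta>] \<times> [-T, T]\<close> with the weight \<open>\<sigma> - \<alpha>\<close>, which vanishes on the left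
  side, expresses the area integral of \<open>(\<sigma> - \<alpha>) \<Delta>w\<close> by boundary terms.
  The vertical sides give, as \<open>\<beta> \<rightarrow> \<infinity>\<close>, the integral of \<open>w (\<alpha> + i t) - ln (1 + \<bar>f (+\<infinity>)\<bar>)\<close>
  over \<open>[-T, T]\<close>. The horizontal sides give an integral of \<open>(\<sigma> - \<alpha>) \<partial>w/\<partial>t\<close>, which is
  bounded independently of \<open>T\<close> because \<open>\<bar>\<nabla>w\<bar> \<le> \<bar>f'\<bar>\<close> decays like \<open>2 powr - \<sigma>\<close>.
  After division by \<open>2 T\<close> the horizontal contribution disappears, so on each vertical line
  the mean of \<open>w\<close> equals \<open>ln (1 + \<bar>a 1\<bar>)\<close> plus the limit of the area means
  (\<open>jensen_formula_vertical_line\<close>).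

  Three points need care. First, \<open>w\<close> is not smooth at the zeros of \<open>f\<close>. Green's formula is
  therefore applied to \<open>ln (1 + sqrt (\<epsilon> + \<bar>f\<bar>\<^sup>2))\<close>, whose Laplacian is nonnegative and
  explicit. Fatou's lemma shows that the limiting density is integrable, and since the
  regularised densities are at most a constant times the limiting one, dominated convergence
  then gives the limit \<open>\<epsilon> \<rightarrow> 0\<close> (\<open>lp_integral_estimate\<close>). The convergence holds off the
  zeros of \<open>f\<close>, which are countably many and hence form a null set.

  Second, the mean values over vertical lines must exist. There \<open>f\<close> is a uniform limit of
  trigonometric polynomials, and such limits stay in their class under composition with a
  continuous function, by the Weierstrass approximation theorem; each of them has a mean
  (\<open>mean_value_tendsto\<close>).

  Third, the limit \<open>\<sigma>\<^sub>0 \<rightarrow> 0\<close> exists because the area integrals decrease in \<open>\<sigma>\<^sub>0\<close>, hence so do the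
  means of \<open>w\<close>; the hypothesis on \<open>log_plus\<close> bounds them through
  \<open>ln (1 + x) \<le> ln 2 + log_plus x\<close> (\<open>log_mean_bounded\<close>).
\<close>

section \<open>A smooth regularisation of the logarithm of one plus the modulus\<close>

lemma has_real_derivative_of_norm_square:
  fixes g :: "real \<Rightarrow> complex"
  assumes "(g has_vector_derivative g1) (at x within S)"
  shows "((\<lambda>x. (norm (g x))\<^sup>2) has_real_derivative 2 * Re (cnj (g x) * g1)) (at x within S)"
proof -
  have "((\<lambda>x. g x * cnj (g x)) has_vector_derivative (g x * cnj g1 + g1 * cnj (g x))) (at x within S)"
    by (intro has_vector_derivative_mult has_vector_derivative_cnj assms)
  from bounded_linear.has_vector_derivative[OF bounded_linear_Re this]
  show ?thesis
    unfolding has_real_derivative_iff_has_vector_derivative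
    by (simp add: complex_mult_cnj cmod_power2 algebra_simps)
qed

lemma has_real_derivative_Re_cnj_mult:
  fixes g :: "real \<Rightarrow> complex"
  assumes "(g has_vector_derivative g1 x) (at x within S)" "(g1 has_vector_derivative g2) (at x within S)"
  shows "((\<lambda>x. Re (cnj (g x) * g1 x)) has_real_derivative (norm (g1 x))\<^sup>2 + Re (cnj (g x) * g2)) (at x within S)"
proof -
  have "((\<lambda>x. cnj (g x) * g1 x) has_vector_derivative (cnj (g x) * g2 + cnj (g1 x) * g1 x)) (at x within S)"
    by (intro has_vector_derivative_mult has_vector_derivative_cnj assms)
  from bounded_linear.has_vector_derivative[OF bounded_linear_Re this]
  show ?thesis
    unfolding has_real_derivative_iff_has_vector_derivative
    by (simp only: cmod_power2) (simp add: algebra_simps power2_eq_square)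
qed

text \<open>
  The variable \<open>u\<close> stands for \<open>\<bar>f\<bar>\<^sup>2\<close>, which is smooth also at the zeros of \<open>f\<close>, whereas
  \<open>\<bar>f\<bar>\<close> is not. The two functions after \<open>log_reg\<close> are its derivatives in \<open>u\<close>.
\<close>
definition log_reg :: "real \<Rightarrow> real \<Rightarrow> real" where
  "log_reg \<epsilon> u = ln (1 + sqrt (\<epsilon> + u))"
definition log_reg' :: "real \<Rightarrow> real \<Rightarrow> real" where
  "log_reg' \<epsilon> u = 1 / (2 * sqrt (\<epsilon> + u) * (1 + sqrt (\<epsilon> + u)))"
definition log_reg'' :: "real \<Rightarrow> real \<Rightarrow> real" where
  "log_reg'' \<epsilon> u = - (1 + 2 * sqrt (\<epsilon> + u)) / (4 * sqrt (\<epsilon> + u) ^ 3 * (1 + sqrt (\<epsilon> + u))\<^sup>2)"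

lemma DERIV_log_reg:
  assumes "\<epsilon> > 0" "u \<ge> 0"
  shows "(log_reg \<epsilon> has_real_derivative log_reg' \<epsilon> u) (at u)"
proof -
  have r: "sqrt (\<epsilon> + u) > 0" using assms by simp
  then have "1 + sqrt (\<epsilon> + u) > 0" by linarith
  with r assms show ?thesis unfolding log_reg_def[abs_def] log_reg'_def
    by (auto intro!: derivative_eq_intros simp: divide_simps)
qed

lemma DERIV_log_reg':
  assumes "\<epsilon> > 0" "u \<ge> 0"
  shows "(log_reg' \<epsilon> has_real_derivative log_reg'' \<epsilon> u) (at u)"
proof -
  define r where "r = sqrt (\<epsilon> + u)"
  have r: "r > 0" using assms by (simp add: r_def)
  have d: "((\<lambda>u. sqrt (\<epsilon> + u)) has_real_derivative 1 / (2 * r)) (at u)"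
    using assms unfolding r_def by (auto intro!: derivative_eq_intros simp: divide_simps)
  have "(log_reg' \<epsilon> has_real_derivative - ((2 * (1 / (2 * r))) * (1 + r) + (1 / (2 * r)) * (2 * r)) / (2 * r * (1 + r))\<^sup>2) (at u)"
    unfolding log_reg'_def[abs_def]
    by (rule derivative_eq_intros d refl)+ (use r in \<open>auto simp: r_def[symmetric] power2_eq_square\<close>)
  also have "- ((2 * (1 / (2 * r))) * (1 + r) + (1 / (2 * r)) * (2 * r)) / (2 * r * (1 + r))\<^sup>2 = log_reg'' \<epsilon> u"
    unfolding log_reg''_def r_def[symmetric] using r
    by (simp add: divide_simps) (simp add: power2_eq_square power3_eq_cube algebra_simps)
  finally show ?thesis .
qed

lemma continuous_on_log_reg:
  assumes "\<epsilon> > 0"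
  shows "continuous_on {0..} (log_reg \<epsilon>)" "continuous_on {0..} (log_reg' \<epsilon>)" "continuous_on {0..} (log_reg'' \<epsilon>)"
proof -
  have *: "sqrt (\<epsilon> + u) > 0" if "u \<in> {0..}" for u using assms that by simp
  then have "1 + sqrt (\<epsilon> + u) \<noteq> 0" "sqrt (\<epsilon> + u) \<noteq> 0" if "u \<in> {0..}" for u using that by fastforce+
  then show "continuous_on {0..} (log_reg \<epsilon>)" "continuous_on {0..} (log_reg' \<epsilon>)" "continuous_on {0..} (log_reg'' \<epsilon>)"
    unfolding log_reg_def[abs_def] log_reg'_def[abs_def] log_reg''_def[abs_def] 
    by (auto intro!: continuous_intros)
qed

text \<open>
  The next three functions take the values \<open>w\<close>, \<open>w1\<close>, \<open>w2\<close> of a curve and of its first and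
  second derivatives. Then \<open>grad_reg\<close> and \<open>hess_reg\<close> are the first and second derivatives of
  \<open>log_reg \<epsilon> (\<bar>g x\<bar>\<^sup>2)\<close> along a curve \<open>g\<close>, while \<open>lap_reg\<close> is the Laplacian of
  \<open>log_reg \<epsilon> (\<bar>f\<bar>\<^sup>2)\<close> for holomorphic \<open>f\<close>, with \<open>w1\<close> the complex derivative.
  Its first summand tends to \<open>lp_density\<close>, its second one to \<open>0\<close> off the zeros.
\<close>
definition grad_reg :: "real \<Rightarrow> complex \<Rightarrow> complex \<Rightarrow> real" where
  "grad_reg \<epsilon> w w1 = log_reg' \<epsilon> ((norm w)\<^sup>2) * (2 * Re (cnj w * w1))"
definition hess_reg :: "real \<Rightarrow> complex \<Rightarrow> complex \<Rightarrow> complex \<Rightarrow> real" where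
  "hess_reg \<epsilon> w w1 w2 = log_reg'' \<epsilon> ((norm w)\<^sup>2) * (2 * Re (cnj w * w1))\<^sup>2
     + log_reg' \<epsilon> ((norm w)\<^sup>2) * (2 * ((norm w1)\<^sup>2 + Re (cnj w * w2)))"
definition lap_reg :: "real \<Rightarrow> complex \<Rightarrow> complex \<Rightarrow> real" where
  "lap_reg \<epsilon> w w1 = (norm w1)\<^sup>2 * 
     (1 / (sqrt (\<epsilon> + (norm w)\<^sup>2) * (1 + sqrt (\<epsilon> + (norm w)\<^sup>2))\<^sup>2)
      + \<epsilon> * (1 + 2 * sqrt (\<epsilon> + (norm w)\<^sup>2)) / (sqrt (\<epsilon> + (norm w)\<^sup>2) ^ 3 * (1 + sqrt (\<epsilon> + (norm w)\<^sup>2))\<^sup>2))"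

lemma DERIV_log_reg_along:
  assumes "\<epsilon> > 0" "(g has_vector_derivative g1) (at x within S)"
  shows "((\<lambda>x. log_reg \<epsilon> ((norm (g x))\<^sup>2)) has_real_derivative grad_reg \<epsilon> (g x) g1) (at x within S)"
  unfolding grad_reg_def
  by (rule DERIV_chain2[OF DERIV_log_reg has_real_derivative_of_norm_square]) (use assms in auto)

lemma DERIV_grad_reg_along:
  assumes "\<epsilon> > 0" "(g has_vector_derivative g1 x) (at x within S)" "(g1 has_vector_derivative g2) (at x within S)"
  shows "((\<lambda>x. grad_reg \<epsilon> (g x) (g1 x)) has_real_derivative hess_reg \<epsilon> (g x) (g1 x) g2) (at x within S)"
proof -
  have 1: "((\<lambda>x. log_reg' \<epsilon> ((norm (g x))\<^sup>2)) has_real_derivative log_reg'' \<epsilon> ((norm (g x))\<^sup>2) * (2 * Re (cnj (g x) * g1 x))) (at x within S)"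
    by (rule DERIV_chain2[OF DERIV_log_reg' has_real_derivative_of_norm_square]) (use assms in auto)
  show ?thesis unfolding grad_reg_def hess_reg_def
    by (rule derivative_eq_intros 1 has_real_derivative_Re_cnj_mult[OF assms(2,3)] refl)+
       (simp add: power2_eq_square algebra_simps)
qed

text \<open>
  Along a horizontal line the derivatives of \<open>f\<close> are \<open>f'\<close> and \<open>f''\<close>, along a vertical line
  they are \<open>i f'\<close> and \<open>- f''\<close>. In the sum of the two second derivatives the terms with \<open>f''\<close>
  cancel, and the squared first-order terms add up to \<open>\<bar>f\<bar>\<^sup>2 \<bar>f'\<bar>\<^sup>2\<close> by Pythagoras.
\<close>
lemma laplacian_reg:
  assumes "\<epsilon> > 0"
  shows "hess_reg \<epsilon> w w1 w2 + hess_reg \<epsilon> w (\<i> * w1) (- w2) = lap_reg \<epsilon> w w1"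
proof -
  define r where "r = sqrt (\<epsilon> + (norm w)\<^sup>2)"
  have r: "r > 0" "r\<^sup>2 = \<epsilon> + (norm w)\<^sup>2" using assms by (simp_all add: r_def add_pos_nonneg)
  have e: "(norm w)\<^sup>2 = r\<^sup>2 - \<epsilon>" using r by simp
  have "(Re (cnj w * w1))\<^sup>2 + (Re (cnj w * (\<i> * w1)))\<^sup>2 = (norm (cnj w * w1))\<^sup>2"
    by (simp add: cmod_power2) (simp add: algebra_simps power2_eq_square)
  also have "\<dots> = (norm w)\<^sup>2 * (norm w1)\<^sup>2" by (simp add: norm_mult power_mult_distrib)
  finally have *: "(Re (cnj w * w1))\<^sup>2 + (Re (cnj w * (\<i> * w1)))\<^sup>2 = (r\<^sup>2 - \<epsilon>) * (norm w1)\<^sup>2" using e by simp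
  have "hess_reg \<epsilon> w w1 w2 + hess_reg \<epsilon> w (\<i> * w1) (- w2) =
     4 * log_reg'' \<epsilon> ((norm w)\<^sup>2) * ((Re (cnj w * w1))\<^sup>2 + (Re (cnj w * (\<i> * w1)))\<^sup>2) + 4 * log_reg' \<epsilon> ((norm w)\<^sup>2) * (norm w1)\<^sup>2"
    unfolding hess_reg_def power_mult_distrib by (simp add: norm_mult algebra_simps)
  also have "\<dots> = (norm w1)\<^sup>2 * (4 * log_reg'' \<epsilon> ((norm w)\<^sup>2) * (r\<^sup>2 - \<epsilon>) + 4 * log_reg' \<epsilon> ((norm w)\<^sup>2))"
    unfolding * by (simp add: algebra_simps)
  also have "4 * log_reg'' \<epsilon> ((norm w)\<^sup>2) * (r\<^sup>2 - \<epsilon>) + 4 * log_reg' \<epsilon> ((norm w)\<^sup>2)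
      = 1 / (r * (1 + r)\<^sup>2) + \<epsilon> * (1 + 2 * r) / (r ^ 3 * (1 + r)\<^sup>2)"
    unfolding log_reg'_def log_reg''_def r_def[symmetric] using r(1)
    by (simp add: divide_simps) (simp add: power2_eq_square power3_eq_cube algebra_simps)
  finally show ?thesis by (simp add: lap_reg_def r_def)
qed

text \<open>
  The map \<open>w \<mapsto> ln (1 + sqrt (\<epsilon> + \<bar>w\<bar>\<^sup>2))\<close> is 1-Lipschitz for every \<open>\<epsilon>\<close>. This uniformity keeps the
  boundary terms of Green's formula under control as \<open>\<epsilon> \<rightarrow> 0\<close>.
\<close>
lemma abs_grad_reg_le:
  assumes "\<epsilon> > 0"
  shows "\<bar>grad_reg \<epsilon> w w1\<bar> \<le> norm w1"
proof -
  define r where "r = sqrt (\<epsilon> + (norm w)\<^sup>2)"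
  have r: "r > 0" using assms by (simp add: r_def add_pos_nonneg)
  have w: "norm w \<le> r" using assms by (simp add: r_def real_le_rsqrt)
  have "\<bar>Re (cnj w * w1)\<bar> \<le> norm w * norm w1"
    using abs_Re_le_cmod[of "cnj w * w1"] by (simp add: norm_mult)
  also have "\<dots> \<le> r * norm w1" by (intro mult_right_mono w) auto
  finally have "\<bar>grad_reg \<epsilon> w w1\<bar> \<le> \<bar>1 / (2 * r * (1 + r))\<bar> * (2 * (r * norm w1))"
    unfolding grad_reg_def log_reg'_def r_def[symmetric] abs_mult by (intro mult_left_mono) auto
  also have "\<dots> = norm w1 / (1 + r)" using r by (simp add: divide_simps)
  also have "\<dots> \<le> norm w1" using r by (simp add: divide_simps mult_le_cancel_left1)
  finally show ?thesis .
qed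

lemma lap_reg_nonneg: "\<epsilon> > 0 \<Longrightarrow> lap_reg \<epsilon> w w1 \<ge> 0"
  unfolding lap_reg_def by (intro mult_nonneg_nonneg add_nonneg_nonneg divide_nonneg_nonneg) auto

text \<open>
  This is the majorant for dominated convergence. From \<open>\<epsilon> \<le> r\<^sup>2\<close> with \<open>r = sqrt (\<epsilon> + \<bar>w\<bar>\<^sup>2)\<close> the whole
  Laplacian is at most \<open>2 \<bar>w1\<bar>\<^sup>2 / (r (1 + r))\<close>, hence at most \<open>3 \<bar>w1\<bar>\<^sup>2 / \<bar>w\<bar>\<close>, and where \<open>w\<close> is bounded
  this is comparable to the limiting density.
\<close>
lemma lap_reg_le:
  assumes "\<epsilon> > 0" "w \<noteq> 0" "norm w \<le> M"
  shows "lap_reg \<epsilon> w w1 \<le> 3 * (1 + M)\<^sup>2 * ((norm w1)\<^sup>2 / (norm w * (1 + norm w)\<^sup>2))"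
proof -
  define r where "r = sqrt (\<epsilon> + (norm w)\<^sup>2)"
  have r: "r > 0" "r\<^sup>2 = \<epsilon> + (norm w)\<^sup>2" using assms by (simp_all add: r_def add_pos_nonneg)
  have w: "norm w \<le> r" using assms by (simp add: r_def real_le_rsqrt)
  have w0: "norm w > 0" using assms by simp
  have er: "\<epsilon> \<le> r\<^sup>2" using r by simp
  have "1 / (r * (1 + r)\<^sup>2) + \<epsilon> * (1 + 2 * r) / (r ^ 3 * (1 + r)\<^sup>2) \<le> 1 / (r * (1 + r)\<^sup>2) + r\<^sup>2 * (1 + 2 * r) / (r ^ 3 * (1 + r)\<^sup>2)"
    using er r by (intro add_left_mono divide_right_mono mult_right_mono) auto
  also have "\<dots> = 2 / (r * (1 + r))"
    using r(1) by (simp add: divide_simps) (simp add: power2_eq_square power3_eq_cube algebra_simps)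
  also have "\<dots> \<le> 3 / norm w"
  proof -
    have "2 / (r * (1 + r)) \<le> 2 / r" using r(1) by (simp add: divide_simps)
    also have "\<dots> \<le> 2 / norm w" using w w0 by (intro divide_left_mono mult_pos_pos r) auto
    also have "\<dots> \<le> 3 / norm w" using w0 by (intro divide_right_mono) auto
    finally show ?thesis .
  qed
  also have "\<dots> \<le> 3 * (1 + M)\<^sup>2 / (norm w * (1 + norm w)\<^sup>2)"
  proof -
    have "(1 + norm w)\<^sup>2 \<le> (1 + M)\<^sup>2" using assms by (intro power_mono) auto
    then have "3 * (1 + norm w)\<^sup>2 / (norm w * (1 + norm w)\<^sup>2) \<le> 3 * (1 + M)\<^sup>2 / (norm w * (1 + norm w)\<^sup>2)"
      by (intro divide_right_mono) auto
    moreover have "1 + norm w \<noteq> 0" using w0 by linarith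
    ultimately show ?thesis using w0 by simp
  qed
  finally have "(norm w1)\<^sup>2 * (1 / (r * (1 + r)\<^sup>2) + \<epsilon> * (1 + 2 * r) / (r ^ 3 * (1 + r)\<^sup>2)) \<le> (norm w1)\<^sup>2 * (3 * (1 + M)\<^sup>2 / (norm w * (1 + norm w)\<^sup>2))"
    by (intro mult_left_mono) auto
  then show ?thesis by (simp add: lap_reg_def r_def algebra_simps)
qed

lemma lap_reg_tendsto:
  assumes "w \<noteq> 0" "e \<longlonglongrightarrow> 0"
  shows "(\<lambda>n. lap_reg (e n) w w1) \<longlonglongrightarrow> (norm w1)\<^sup>2 / (norm w * (1 + norm w)\<^sup>2)"
proof -
  have [simp]: "1 + norm w \<noteq> 0" using norm_ge_zero[of w] by linarith
  have s: "(\<lambda>n. sqrt (e n + (norm w)\<^sup>2)) \<longlonglongrightarrow> norm w"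
    using tendsto_real_sqrt[OF tendsto_add[OF assms(2) tendsto_const[of "(norm w)\<^sup>2"]]] by simp
  have "(\<lambda>n. lap_reg (e n) w w1) \<longlonglongrightarrow> (norm w1)\<^sup>2 * 
     (1 / (norm w * (1 + norm w)\<^sup>2) + 0 * (1 + 2 * norm w) / (norm w ^ 3 * (1 + norm w)\<^sup>2))"
    unfolding lap_reg_def by (intro tendsto_intros s assms) (use assms in auto)
  then show ?thesis by simp
qed

text \<open>
  The error \<open>sqrt \<epsilon>\<close> is uniform in \<open>w\<close>, so that the boundary integrals of the regularised
  function converge as \<open>\<epsilon> \<rightarrow> 0\<close>, with an explicit rate.
\<close>
lemma log_reg_bounds:
  assumes "\<epsilon> > 0"
  shows "ln (1 + norm w) \<le> log_reg \<epsilon> ((norm w)\<^sup>2)" "log_reg \<epsilon> ((norm w)\<^sup>2) \<le> ln (1 + norm w) + sqrt \<epsilon>"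
proof -
  have w: "norm w \<le> sqrt (\<epsilon> + (norm w)\<^sup>2)" using assms by (simp add: real_le_rsqrt)
  have p: "1 + norm w > 0" using norm_ge_zero[of w] by linarith
  show "ln (1 + norm w) \<le> log_reg \<epsilon> ((norm w)\<^sup>2)"
    unfolding log_reg_def using w p by (subst ln_le_cancel_iff) auto
  have "sqrt (\<epsilon> + (norm w)\<^sup>2) \<le> sqrt \<epsilon> + sqrt ((norm w)\<^sup>2)"
    using assms by (intro sqrt_add_le_add_sqrt) auto
  then have "log_reg \<epsilon> ((norm w)\<^sup>2) \<le> ln (1 + norm w + sqrt \<epsilon>)"
    unfolding log_reg_def using w p by (subst ln_le_cancel_iff) (use assms in auto)
  also have "1 + norm w + sqrt \<epsilon> = (1 + norm w) * (1 + sqrt \<epsilon> / (1 + norm w))" using p by (simp add: field_simps)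
  also have "ln \<dots> = ln (1 + norm w) + ln (1 + sqrt \<epsilon> / (1 + norm w))"
    using p assms by (intro ln_mult_pos) (auto intro: add_pos_nonneg)
  also have "ln (1 + sqrt \<epsilon> / (1 + norm w)) \<le> sqrt \<epsilon> / (1 + norm w)"
    using p assms by (intro ln_add_one_self_le_self) auto
  also have "\<dots> \<le> sqrt \<epsilon>" using p assms by (simp add: divide_simps mult_le_cancel_left1)
  finally show "log_reg \<epsilon> ((norm w)\<^sup>2) \<le> ln (1 + norm w) + sqrt \<epsilon>" by simp
qed

lemma ln_one_plus_Lipschitz:
  fixes x y :: real
  assumes "x \<ge> 0" "y \<ge> 0"
  shows "\<bar>ln (1 + x) - ln (1 + y)\<bar> \<le> \<bar>x - y\<bar>"
proof -
  have *: "ln (1 + x) - ln (1 + y) \<le> \<bar>x - y\<bar>" if "x \<ge> 0" "y \<ge> 0" for x y :: real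
  proof -
    have "ln (1 + x) - ln (1 + y) = ln ((1 + x) / (1 + y))" using that by (simp add: ln_div)
    also have "\<dots> \<le> (1 + x) / (1 + y) - 1" using that by (intro ln_le_minus_one) auto
    also have "\<dots> = (x - y) / (1 + y)" using that by (simp add: field_simps)
    also have "\<dots> \<le> \<bar>x - y\<bar> / (1 + y)" using that by (intro divide_right_mono) auto
    also have "\<dots> \<le> \<bar>x - y\<bar>" using that by (simp add: divide_simps mult_le_cancel_left1)
    finally show ?thesis .
  qed
  show ?thesis using *[OF assms] *[OF assms(2,1)] by linarith
qed

section \<open>Green's formula on a rectangle\<close>

lemma continuous_on_along:
  assumes "f holomorphic_on S" "continuous_on A h" "h ` A \<subseteq> S"
  shows "continuous_on A (\<lambda>p. f (h p))"
  by (rule continuous_on_compose2[OF holomorphic_on_imp_continuous_on[OF assms(1)] assms(2,3)])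

lemma continuous_on_hess_reg:
  assumes "\<epsilon> > 0" "continuous_on A g" "continuous_on A g1" "continuous_on A g2"
  shows "continuous_on A (\<lambda>p. hess_reg \<epsilon> (g p) (g1 p) (g2 p))"
  unfolding hess_reg_def
  by (intro continuous_intros assms
        continuous_on_compose2[OF continuous_on_log_reg(2)[OF assms(1)]]
        continuous_on_compose2[OF continuous_on_log_reg(3)[OF assms(1)]]) auto

lemma continuous_on_grad_reg:
  assumes "\<epsilon> > 0" "continuous_on A g" "continuous_on A g1"
  shows "continuous_on A (\<lambda>p. grad_reg \<epsilon> (g p) (g1 p))"
  unfolding grad_reg_def
  by (intro continuous_intros assms
        continuous_on_compose2[OF continuous_on_log_reg(2)[OF assms(1)]]) auto

lemma continuous_on_log_reg_norm:
  assumes "\<epsilon> > 0" "continuous_on A g"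
  shows "continuous_on A (\<lambda>p. log_reg \<epsilon> ((norm (g p))\<^sup>2))"
  by (intro continuous_intros assms
        continuous_on_compose2[OF continuous_on_log_reg(1)[OF assms(1)]]) auto

lemma horizontal_vector_derivative:
  assumes "g holomorphic_on S" "open S" "Complex \<sigma> t \<in> S"
  shows "((\<lambda>\<sigma>. g (Complex \<sigma> t)) has_vector_derivative deriv g (Complex \<sigma> t)) (at \<sigma> within X)"
proof -
  have "((\<lambda>\<sigma>. Complex \<sigma> t) has_vector_derivative 1) (at \<sigma> within X)"
    unfolding Complex_eq by (auto intro!: derivative_eq_intros)
  from field_vector_diff_chain_within[OF this, of g "deriv g (Complex \<sigma> t)"]
  show ?thesis
    using holomorphic_derivI[OF assms] by (simp add: o_def)
qed

lemma vertical_vector_derivative: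
  assumes "g holomorphic_on S" "open S" "Complex \<sigma> t \<in> S"
  shows "((\<lambda>t. g (Complex \<sigma> t)) has_vector_derivative \<i> * deriv g (Complex \<sigma> t)) (at t within X)"
proof -
  have "((\<lambda>t. Complex \<sigma> t) has_vector_derivative \<i>) (at t within X)"
    unfolding Complex_eq by (auto intro!: derivative_eq_intros)
  from field_vector_diff_chain_within[OF this, of g "deriv g (Complex \<sigma> t)"]
  show ?thesis
    using holomorphic_derivI[OF assms] by (simp add: o_def)
qed

text \<open>
  The second derivative in \<open>\<sigma>\<close> is integrated first in \<open>\<sigma>\<close>, with the primitive
  \<open>(\<sigma> - \<alpha>) w\<^sub>\<sigma> - w\<close>, and the one in \<open>t\<close> first in \<open>t\<close>, so only the
  fundamental theorem of calculus and Fubini's theorem for continuous functions enter.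
  Because of the weight no derivative appears on the side \<open>\<sigma> = \<alpha>\<close>.
\<close>
lemma green_rectangle:
  assumes f: "f holomorphic_on S" "open S" and \<epsilon>: "\<epsilon> > 0" and "\<alpha> \<le> \<beta>" "0 < T"
    and S: "\<And>\<sigma> t. \<sigma> \<in> {\<alpha>..\<beta>} \<Longrightarrow> t \<in> {-T..T} \<Longrightarrow> Complex \<sigma> t \<in> S"
  defines "F \<equiv> \<lambda>\<sigma> t. f (Complex \<sigma> t)" and "F1 \<equiv> \<lambda>\<sigma> t. deriv f (Complex \<sigma> t)"
  shows "integral (cbox (\<alpha>,-T) (\<beta>,T)) (\<lambda>(\<sigma>,t). (\<sigma> - \<alpha>) * lap_reg \<epsilon> (F \<sigma> t) (F1 \<sigma> t)) =
      integral {-T..T} (\<lambda>t. (\<beta> - \<alpha>) * grad_reg \<epsilon> (F \<beta> t) (F1 \<beta> t)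
        - log_reg \<epsilon> ((norm (F \<beta> t))\<^sup>2) + log_reg \<epsilon> ((norm (F \<alpha> t))\<^sup>2))
    + integral {\<alpha>..\<beta>} (\<lambda>\<sigma>. (\<sigma> - \<alpha>) * (grad_reg \<epsilon> (F \<sigma> T) (\<i> * F1 \<sigma> T)
        - grad_reg \<epsilon> (F \<sigma> (-T)) (\<i> * F1 \<sigma> (-T))))"
proof -
  have f1: "deriv f holomorphic_on S" and f2: "deriv (deriv f) holomorphic_on S"
    using f by (auto intro!: holomorphic_deriv)
  define F2 where "F2 = (\<lambda>\<sigma> t. deriv (deriv f) (Complex \<sigma> t))"
  define A where "A = (\<lambda>\<sigma> t. (\<sigma> - \<alpha>) * hess_reg \<epsilon> (F \<sigma> t) (F1 \<sigma> t) (F2 \<sigma> t))"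
  define B where "B = (\<lambda>\<sigma> t. (\<sigma> - \<alpha>) * hess_reg \<epsilon> (F \<sigma> t) (\<i> * F1 \<sigma> t) (- F2 \<sigma> t))"
  let ?Q = "cbox (\<alpha>,-T) (\<beta>,T)"
  have Q: "(\<lambda>p. Complex (fst p) (snd p)) ` ?Q \<subseteq> S"
    using S by (auto simp: cbox_Pair_eq)
  have cF: "continuous_on ?Q (\<lambda>p. F (fst p) (snd p))" "continuous_on ?Q (\<lambda>p. F1 (fst p) (snd p))"
    "continuous_on ?Q (\<lambda>p. F2 (fst p) (snd p))"
    unfolding F_def F1_def F2_def
    by (intro continuous_on_along[OF f(1) _ Q] continuous_on_along[OF f1 _ Q]
        continuous_on_along[OF f2 _ Q] continuous_intros)+
  have cA: "continuous_on ?Q (\<lambda>(\<sigma>,t). A \<sigma> t)" and cB: "continuous_on ?Q (\<lambda>(\<sigma>,t). B \<sigma> t)"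
    unfolding A_def B_def case_prod_unfold
    by (intro continuous_intros continuous_on_hess_reg cF \<epsilon>)+
  have "(\<sigma> - \<alpha>) * lap_reg \<epsilon> (F \<sigma> t) (F1 \<sigma> t) = A \<sigma> t + B \<sigma> t" for \<sigma> t
    unfolding A_def B_def laplacian_reg[OF \<epsilon>, of "F \<sigma> t" "F1 \<sigma> t" "F2 \<sigma> t", symmetric]
    by (rule distrib_left)
  then have "(\<lambda>(\<sigma>,t). (\<sigma> - \<alpha>) * lap_reg \<epsilon> (F \<sigma> t) (F1 \<sigma> t)) = (\<lambda>p. (case p of (\<sigma>,t) \<Rightarrow> A \<sigma> t) + (case p of (\<sigma>,t) \<Rightarrow> B \<sigma> t))"
    by (simp add: fun_eq_iff)
  then have "integral ?Q (\<lambda>(\<sigma>,t). (\<sigma> - \<alpha>) * lap_reg \<epsilon> (F \<sigma> t) (F1 \<sigma> t)) =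
      integral ?Q (\<lambda>(\<sigma>,t). A \<sigma> t) + integral ?Q (\<lambda>(\<sigma>,t). B \<sigma> t)"
    by (simp only:) (intro integral_add integrable_continuous cA cB)
  also have "integral ?Q (\<lambda>(\<sigma>,t). A \<sigma> t) = integral {-T..T} (\<lambda>t. integral {\<alpha>..\<beta>} (\<lambda>\<sigma>. A \<sigma> t))"
    using integral_prod_continuous[OF cA] integral_swap_continuous[OF cA] by simp
  also have "\<dots> = integral {-T..T} (\<lambda>t. (\<beta> - \<alpha>) * grad_reg \<epsilon> (F \<beta> t) (F1 \<beta> t)
        - log_reg \<epsilon> ((norm (F \<beta> t))\<^sup>2) + log_reg \<epsilon> ((norm (F \<alpha> t))\<^sup>2))"
  proof (rule integral_cong)
    fix t assume t: "t \<in> {-T..T}"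
    let ?G = "\<lambda>\<sigma>. (\<sigma> - \<alpha>) * grad_reg \<epsilon> (F \<sigma> t) (F1 \<sigma> t) - log_reg \<epsilon> ((norm (F \<sigma> t))\<^sup>2)"
    have "((\<lambda>\<sigma>. A \<sigma> t) has_integral ?G \<beta> - ?G \<alpha>) {\<alpha>..\<beta>}"
    proof (rule fundamental_theorem_of_calculus[OF \<open>\<alpha> \<le> \<beta>\<close>])
      fix \<sigma> assume \<sigma>: "\<sigma> \<in> {\<alpha>..\<beta>}"
      have d1: "((\<lambda>\<sigma>. F \<sigma> t) has_vector_derivative F1 \<sigma> t) (at \<sigma> within {\<alpha>..\<beta>})"
        unfolding F_def F1_def by (rule horizontal_vector_derivative[OF f S[OF \<sigma> t]])
      have d2: "((\<lambda>\<sigma>. F1 \<sigma> t) has_vector_derivative F2 \<sigma> t) (at \<sigma> within {\<alpha>..\<beta>})"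
        unfolding F1_def F2_def by (rule horizontal_vector_derivative[OF f1 f(2) S[OF \<sigma> t]])
      have "(?G has_real_derivative A \<sigma> t) (at \<sigma> within {\<alpha>..\<beta>})"
        unfolding A_def
        by (rule derivative_eq_intros DERIV_log_reg_along[OF \<epsilon> d1] DERIV_grad_reg_along[OF \<epsilon> d1 d2] refl)+ simp
      then show "(?G has_vector_derivative A \<sigma> t) (at \<sigma> within {\<alpha>..\<beta>})"
        by (simp add: has_real_derivative_iff_has_vector_derivative)
    qed
    then show "integral {\<alpha>..\<beta>} (\<lambda>\<sigma>. A \<sigma> t) = (\<beta> - \<alpha>) * grad_reg \<epsilon> (F \<beta> t) (F1 \<beta> t)
        - log_reg \<epsilon> ((norm (F \<beta> t))\<^sup>2) + log_reg \<epsilon> ((norm (F \<alpha> t))\<^sup>2)"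
      by (simp add: integral_unique)
  qed
  also have "integral ?Q (\<lambda>(\<sigma>,t). B \<sigma> t) = integral {\<alpha>..\<beta>} (\<lambda>\<sigma>. integral {-T..T} (\<lambda>t. B \<sigma> t))"
    using integral_prod_continuous[OF cB] by simp
  also have "\<dots> = integral {\<alpha>..\<beta>} (\<lambda>\<sigma>. (\<sigma> - \<alpha>) * (grad_reg \<epsilon> (F \<sigma> T) (\<i> * F1 \<sigma> T)
        - grad_reg \<epsilon> (F \<sigma> (-T)) (\<i> * F1 \<sigma> (-T))))"
  proof (rule integral_cong)
    fix \<sigma> assume \<sigma>: "\<sigma> \<in> {\<alpha>..\<beta>}"
    let ?G = "\<lambda>t. (\<sigma> - \<alpha>) * grad_reg \<epsilon> (F \<sigma> t) (\<i> * F1 \<sigma> t)"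
    have "((\<lambda>t. B \<sigma> t) has_integral ?G T - ?G (-T)) {-T..T}"
    proof (rule fundamental_theorem_of_calculus)
      show "-T \<le> T" using \<open>0 < T\<close> by simp
      fix t assume t: "t \<in> {-T..T}"
      have d1: "((\<lambda>t. F \<sigma> t) has_vector_derivative \<i> * F1 \<sigma> t) (at t within {-T..T})"
        unfolding F_def F1_def by (rule vertical_vector_derivative[OF f S[OF \<sigma> t]])
      have "((\<lambda>t. F1 \<sigma> t) has_vector_derivative \<i> * F2 \<sigma> t) (at t within {-T..T})"
        unfolding F1_def F2_def by (rule vertical_vector_derivative[OF f1 f(2) S[OF \<sigma> t]])
      from has_vector_derivative_mult_right[OF this, of \<i>]
      have d2: "((\<lambda>t. \<i> * F1 \<sigma> t) has_vector_derivative - F2 \<sigma> t) (at t within {-T..T})"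
        by (simp flip: mult.assoc)
      have "(?G has_real_derivative B \<sigma> t) (at t within {-T..T})"
        unfolding B_def
        by (rule derivative_eq_intros DERIV_grad_reg_along[OF \<epsilon> d1 d2] refl)+ simp
      then show "(?G has_vector_derivative B \<sigma> t) (at t within {-T..T})"
        by (simp add: has_real_derivative_iff_has_vector_derivative)
    qed
    then show "integral {-T..T} (\<lambda>t. B \<sigma> t) = (\<sigma> - \<alpha>) * (grad_reg \<epsilon> (F \<sigma> T) (\<i> * F1 \<sigma> T)
        - grad_reg \<epsilon> (F \<sigma> (-T)) (\<i> * F1 \<sigma> (-T)))"
      by (simp add: integral_unique algebra_simps)
  qed
  finally show ?thesis .
qed

lemma integral_linear_exp_le:
  fixes k :: real
  assumes "k > 0" "\<alpha> \<le> \<beta>"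
  shows "integral {\<alpha>..\<beta>} (\<lambda>\<sigma>. (\<sigma> - \<alpha>) * exp (- k * (\<sigma> - \<alpha>))) \<le> 1 / k\<^sup>2"
proof -
  let ?G = "\<lambda>\<sigma>. - ((\<sigma> - \<alpha>) / k + 1 / k\<^sup>2) * exp (- k * (\<sigma> - \<alpha>))"
  have "((\<lambda>\<sigma>. (\<sigma> - \<alpha>) * exp (- k * (\<sigma> - \<alpha>))) has_integral ?G \<beta> - ?G \<alpha>) {\<alpha>..\<beta>}"
  proof (rule fundamental_theorem_of_calculus[OF assms(2)])
    fix \<sigma>
    have "(?G has_real_derivative (\<sigma> - \<alpha>) * exp (- k * (\<sigma> - \<alpha>))) (at \<sigma> within {\<alpha>..\<beta>})"
      using assms(1) by (auto intro!: derivative_eq_intros simp: field_simps power2_eq_square)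
    then show "(?G has_vector_derivative (\<sigma> - \<alpha>) * exp (- k * (\<sigma> - \<alpha>))) (at \<sigma> within {\<alpha>..\<beta>})"
      by (simp add: has_real_derivative_iff_has_vector_derivative)
  qed
  then have "integral {\<alpha>..\<beta>} (\<lambda>\<sigma>. (\<sigma> - \<alpha>) * exp (- k * (\<sigma> - \<alpha>))) = ?G \<beta> - ?G \<alpha>"
    by (rule integral_unique)
  also have "?G \<beta> \<le> 0"
    using assms by (intro mult_nonpos_nonneg) (simp_all only: neg_le_0_iff_le exp_ge_zero, simp)
  finally show ?thesis by simp
qed

text \<open>
  The right-hand side has a part that grows with \<open>T\<close> but vanishes as \<open>\<beta> \<rightarrow> \<infinity>\<close> and \<open>\<epsilon> \<rightarrow> 0\<close>,
  coming from the right side of the rectangle and from the regularisation, and the part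
  \<open>2 B / k\<^sup>2\<close>, coming from the two horizontal sides, which does not depend on \<open>T\<close>.
\<close>
lemma regularised_green_estimate:
  assumes f: "f holomorphic_on half_plane \<theta>" and \<theta>: "\<theta> < \<alpha>" and k: "k > 0" and \<epsilon>: "\<epsilon> > 0"
    and \<beta>: "\<alpha> \<le> \<beta>" and T: "0 < T"
    and c: "\<And>s. Re s \<ge> \<alpha> \<Longrightarrow> norm (f s - c) \<le> B * exp (- k * (Re s - \<alpha>))"
    and d: "\<And>s. Re s \<ge> \<alpha> \<Longrightarrow> norm (deriv f s) \<le> B * exp (- k * (Re s - \<alpha>))"
  shows "\<bar>integral (cbox (\<alpha>,-T) (\<beta>,T)) (\<lambda>(\<sigma>,t). (\<sigma> - \<alpha>) * lap_reg \<epsilon> (f (Complex \<sigma> t)) (deriv f (Complex \<sigma> t)))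
     - integral {-T..T} (\<lambda>t. ln (1 + norm (f (Complex \<alpha> t))) - ln (1 + norm c))\<bar>
    \<le> 2 * T * ((\<beta> - \<alpha> + 1) * B * exp (- k * (\<beta> - \<alpha>)) + 2 * sqrt \<epsilon>) + 2 * B / k\<^sup>2"
proof -
  have op: "open (half_plane \<theta>)" unfolding half_plane_def by (rule open_halfspace_Re_gt)
  have B: "B \<ge> 0" using order_trans[OF norm_ge_zero c[of "of_real \<alpha>"]] by simp
  have f1: "deriv f holomorphic_on half_plane \<theta>" using f op by (rule holomorphic_deriv)
  define F where "F = (\<lambda>\<sigma> t. f (Complex \<sigma> t))"
  define F1 where "F1 = (\<lambda>\<sigma> t. deriv f (Complex \<sigma> t))"
  define V where "V = (\<lambda>t. (\<beta> - \<alpha>) * grad_reg \<epsilon> (F \<beta> t) (F1 \<beta> t)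
        - log_reg \<epsilon> ((norm (F \<beta> t))\<^sup>2) + log_reg \<epsilon> ((norm (F \<alpha> t))\<^sup>2))"
  define H where "H = (\<lambda>\<sigma>. (\<sigma> - \<alpha>) * (grad_reg \<epsilon> (F \<sigma> T) (\<i> * F1 \<sigma> T)
        - grad_reg \<epsilon> (F \<sigma> (-T)) (\<i> * F1 \<sigma> (-T))))"
  define W where "W = (\<lambda>t. ln (1 + norm (F \<alpha> t)) - ln (1 + norm c))"
  have cont_t: "continuous_on X (\<lambda>t. F \<sigma> t)" "continuous_on X (\<lambda>t. F1 \<sigma> t)" if "\<sigma> \<ge> \<alpha>" for \<sigma> X
    unfolding F_def F1_def
    by (rule continuous_on_along[OF f] continuous_on_along[OF f1];
        use \<theta> that in \<open>force intro!: continuous_intros simp: half_plane_def\<close>)+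
  have cont_s: "continuous_on {\<alpha>..\<beta>} (\<lambda>\<sigma>. F \<sigma> t)" "continuous_on {\<alpha>..\<beta>} (\<lambda>\<sigma>. F1 \<sigma> t)" for t
    unfolding F_def F1_def
    by (rule continuous_on_along[OF f] continuous_on_along[OF f1];
        use \<theta> in \<open>force intro!: continuous_intros simp: half_plane_def\<close>)+
  have pos: "1 + norm z \<noteq> 0" for z :: complex using norm_ge_zero[of z] by linarith
  have cV: "continuous_on {-T..T} V"
    unfolding V_def using \<beta> by (intro continuous_intros continuous_on_grad_reg continuous_on_log_reg_norm \<epsilon> cont_t) auto
  have cW: "continuous_on {-T..T} W"
    unfolding W_def using pos by (intro continuous_intros cont_t) auto
  have cH: "continuous_on {\<alpha>..\<beta>} H"
    unfolding H_def by (intro continuous_intros continuous_on_grad_reg \<epsilon> cont_s)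
  have eq: "integral (cbox (\<alpha>,-T) (\<beta>,T)) (\<lambda>(\<sigma>,t). (\<sigma> - \<alpha>) * lap_reg \<epsilon> (F \<sigma> t) (F1 \<sigma> t))
      = integral {-T..T} V + integral {\<alpha>..\<beta>} H"
    unfolding V_def H_def F_def F1_def
    by (rule green_rectangle[OF f op \<epsilon> \<beta> T]) (use \<theta> in \<open>auto simp: half_plane_def\<close>)
  have VW: "\<bar>V t - W t\<bar> \<le> (\<beta> - \<alpha> + 1) * B * exp (- k * (\<beta> - \<alpha>)) + 2 * sqrt \<epsilon>" for t
  proof -
    have "\<bar>grad_reg \<epsilon> (F \<beta> t) (F1 \<beta> t)\<bar> \<le> B * exp (- k * (\<beta> - \<alpha>))"
      using abs_grad_reg_le[OF \<epsilon>, of "F \<beta> t" "F1 \<beta> t"] d[of "Complex \<beta> t"] \<beta> by (simp add: F1_def)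
    then have 1: "\<bar>(\<beta> - \<alpha>) * grad_reg \<epsilon> (F \<beta> t) (F1 \<beta> t)\<bar> \<le> (\<beta> - \<alpha>) * (B * exp (- k * (\<beta> - \<alpha>)))"
      using \<beta> by (simp add: abs_mult mult_left_mono)
    have 2: "\<bar>ln (1 + norm (F \<beta> t)) - ln (1 + norm c)\<bar> \<le> B * exp (- k * (\<beta> - \<alpha>))"
      using ln_one_plus_Lipschitz[of "norm (F \<beta> t)" "norm c"] norm_triangle_ineq3[of "F \<beta> t" c]
        c[of "Complex \<beta> t"] \<beta> by (simp add: F_def)
    show ?thesis
      using 1 2 log_reg_bounds[OF \<epsilon>, of "F \<beta> t"] log_reg_bounds[OF \<epsilon>, of "F \<alpha> t"]
      unfolding V_def W_def distrib_right by (simp only: mult_1 mult.assoc)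
  qed
  have "\<bar>integral {-T..T} V - integral {-T..T} W\<bar> = norm (integral {-T..T} (\<lambda>t. V t - W t))"
    by (subst integral_diff) (auto intro: integrable_continuous_real cV cW)
  also have "\<dots> \<le> ((\<beta> - \<alpha> + 1) * B * exp (- k * (\<beta> - \<alpha>)) + 2 * sqrt \<epsilon>) * (T - (-T))"
    using T VW by (intro integral_bound continuous_intros cV cW) auto
  finally have 1: "\<bar>integral {-T..T} V - integral {-T..T} W\<bar> \<le> 2 * T * ((\<beta> - \<alpha> + 1) * B * exp (- k * (\<beta> - \<alpha>)) + 2 * sqrt \<epsilon>)"
    by (simp add: algebra_simps)
  have "\<bar>H \<sigma>\<bar> \<le> 2 * B * ((\<sigma> - \<alpha>) * exp (- k * (\<sigma> - \<alpha>)))" if "\<sigma> \<in> {\<alpha>..\<beta>}" for \<sigma>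
  proof -
    have "\<bar>grad_reg \<epsilon> (F \<sigma> t) (\<i> * F1 \<sigma> t)\<bar> \<le> B * exp (- k * (\<sigma> - \<alpha>))" for t
      using abs_grad_reg_le[OF \<epsilon>, of "F \<sigma> t" "\<i> * F1 \<sigma> t"] d[of "Complex \<sigma> t"] that
      by (simp add: F1_def norm_mult)
    from this[of T] this[of "-T"]
    have "\<bar>grad_reg \<epsilon> (F \<sigma> T) (\<i> * F1 \<sigma> T) - grad_reg \<epsilon> (F \<sigma> (-T)) (\<i> * F1 \<sigma> (-T))\<bar>
        \<le> 2 * (B * exp (- k * (\<sigma> - \<alpha>)))" by linarith
    then have "\<bar>H \<sigma>\<bar> \<le> (\<sigma> - \<alpha>) * (2 * (B * exp (- k * (\<sigma> - \<alpha>))))"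
      unfolding H_def abs_mult using that by (intro mult_mono) auto
    then show ?thesis by (simp add: algebra_simps)
  qed
  then have "norm (integral {\<alpha>..\<beta>} H) \<le> integral {\<alpha>..\<beta>} (\<lambda>\<sigma>. 2 * B * ((\<sigma> - \<alpha>) * exp (- k * (\<sigma> - \<alpha>))))"
    by (intro integral_norm_bound_integral integrable_continuous_real cH continuous_intros) auto
  also have "\<dots> = 2 * B * integral {\<alpha>..\<beta>} (\<lambda>\<sigma>. (\<sigma> - \<alpha>) * exp (- k * (\<sigma> - \<alpha>)))"
    by (rule integral_mult_right)
  also have "\<dots> \<le> 2 * B * (1 / k\<^sup>2)"
    using B by (intro mult_left_mono integral_linear_exp_le k \<beta>) auto
  finally have 2: "\<bar>integral {\<alpha>..\<beta>} H\<bar> \<le> 2 * B / k\<^sup>2" by simp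
  have "\<bar>integral (cbox (\<alpha>,-T) (\<beta>,T)) (\<lambda>(\<sigma>,t). (\<sigma> - \<alpha>) * lap_reg \<epsilon> (F \<sigma> t) (F1 \<sigma> t)) - integral {-T..T} W\<bar>
     \<le> 2 * T * ((\<beta> - \<alpha> + 1) * B * exp (- k * (\<beta> - \<alpha>)) + 2 * sqrt \<epsilon>) + 2 * B / k\<^sup>2"
    using 1 2 unfolding eq by linarith
  then show ?thesis unfolding W_def F_def F1_def .
qed

section \<open>Removal of the regularisation\<close>

lemma estimate_limit:
  fixes k :: real
  assumes "k > 0"
  shows "(\<lambda>n. 2 * T * ((real n + 1) * B * exp (- k * real n) + 2 * sqrt (inverse (real (Suc n)))) + 2 * B / k\<^sup>2) \<longlonglongrightarrow> 2 * B / k\<^sup>2"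
proof -
  have x: "norm (exp (- k)) < 1" using assms by simp
  have "(\<lambda>n. real n * exp (- k) ^ n + exp (- k) ^ n) \<longlonglongrightarrow> 0 + 0"
    by (intro tendsto_add powser_times_n_limit_0[OF x] LIMSEQ_power_zero[OF x])
  then have "(\<lambda>n. B * (real n * exp (- k) ^ n + exp (- k) ^ n)) \<longlonglongrightarrow> B * 0"
    by (intro tendsto_mult_left) simp
  also have "(\<lambda>n. B * (real n * exp (- k) ^ n + exp (- k) ^ n)) = (\<lambda>n. (real n + 1) * B * exp (- k * real n))"
    by (simp add: fun_eq_iff exp_of_nat_mult[symmetric] algebra_simps)
  finally have 1: "(\<lambda>n. (real n + 1) * B * exp (- k * real n)) \<longlonglongrightarrow> 0" by simp
  have 2: "(\<lambda>n. sqrt (inverse (real (Suc n)))) \<longlonglongrightarrow> 0"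
    using tendsto_real_sqrt[OF LIMSEQ_inverse_real_of_nat] by simp
  show ?thesis using tendsto_add[OF tendsto_mult_left[OF tendsto_add[OF 1 tendsto_mult_left[OF 2, of 2]], of "2 * T"]
     tendsto_const[of "2 * B / k\<^sup>2"]] by simp
qed

lemma lp_integral_eq_nn_integral_prod:
  assumes "(\<lambda>p. ennreal (lp_density f (Complex (fst p) (snd p)) * (fst p - \<alpha>)) * indicator ({\<alpha><..} \<times> {-T..T}) p) \<in> borel_measurable borel"
  shows "lp_integral f \<alpha> T =
    (\<integral>\<^sup>+p. ennreal (lp_density f (Complex (fst p) (snd p)) * (fst p - \<alpha>)) * indicator ({\<alpha><..} \<times> {-T..T}) p \<partial>lborel)"
proof -
  let ?D = "\<lambda>p. ennreal (lp_density f (Complex (fst p) (snd p)) * (fst p - \<alpha>)) * indicator ({\<alpha><..} \<times> {-T..T}) p"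
  have "?D \<in> borel_measurable (lborel \<Otimes>\<^sub>M lborel)" using assms by (simp add: lborel_prod)
  from lborel.nn_integral_fst[OF this]
  have "(\<integral>\<^sup>+p. ?D p \<partial>lborel) = (\<integral>\<^sup>+\<sigma>. \<integral>\<^sup>+t. ?D (\<sigma>, t) \<partial>lborel \<partial>lborel)" by (simp add: lborel_prod)
  also have "\<dots> = lp_integral f \<alpha> T"
    unfolding lp_integral_def
  proof (rule nn_integral_cong)
    fix \<sigma> :: real
    show "(\<integral>\<^sup>+t. ?D (\<sigma>, t) \<partial>lborel) =
      (\<integral>\<^sup>+t\<in>{-T..T}. ennreal (lp_density f (Complex \<sigma> t) * (\<sigma> - \<alpha>)) \<partial>lborel) * indicator {\<alpha><..} \<sigma>"
      by (cases "\<sigma> > \<alpha>") (auto simp: indicator_times intro!: nn_integral_cong)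
  qed
  finally show ?thesis by simp
qed

text \<open>
  The parameters \<open>\<epsilon> \<rightarrow> 0\<close> and \<open>\<beta> \<rightarrow> \<infinity>\<close> are sent to their limits along one sequence,
  \<open>\<epsilon> = 1 / (n + 1)\<close> and \<open>\<beta> = \<alpha> + n\<close>. The integrals of the regularised densities are bounded by
  \<open>regularised_green_estimate\<close>, so by Fatou's lemma the limiting density is integrable; it then
  dominates the regularised densities up to the factor \<open>C\<close>, and the estimate passes to the limit.
\<close>
lemma lp_integral_estimate:
  assumes f: "f holomorphic_on half_plane \<theta>" and \<theta>: "\<theta> < \<alpha>" and k: "k > 0" and T: "0 < T"
    and c: "\<And>s. Re s \<ge> \<alpha> \<Longrightarrow> norm (f s - c) \<le> B * exp (- k * (Re s - \<alpha>))"
    and d: "\<And>s. Re s \<ge> \<alpha> \<Longrightarrow> norm (deriv f s) \<le> B * exp (- k * (Re s - \<alpha>))"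
    and z: "countable {s \<in> half_plane \<theta>. f s = 0}"
  shows "\<exists>R\<ge>0. lp_integral f \<alpha> T = ennreal R \<and>
     \<bar>R - integral {-T..T} (\<lambda>t. ln (1 + norm (f (Complex \<alpha> t))) - ln (1 + norm c))\<bar> \<le> 2 * B / k\<^sup>2"
proof -
  define W where "W = integral {-T..T} (\<lambda>t. ln (1 + norm (f (Complex \<alpha> t))) - ln (1 + norm c))"
  define e where "e n = inverse (real (Suc n))" for n
  define Q where "Q n = cbox (\<alpha>,-T) (\<alpha> + real n, T)" for n
  define U where "U = {p :: real \<times> real. fst p > \<theta>}"
  define g where "g p = f (Complex (fst p) (snd p))" for p
  define g1 where "g1 p = deriv f (Complex (fst p) (snd p))" for p
  define h where "h n p = (fst p - \<alpha>) * lap_reg (e n) (g p) (g1 p)" for n p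
  define D where "D n p = ennreal (h n p) * indicator (Q n) p" for n p
  define D0 where "D0 p = ennreal (lp_density f (Complex (fst p) (snd p)) * (fst p - \<alpha>)) * indicator ({\<alpha><..} \<times> {-T..T}) p" for p
  define I where "I n = integral (Q n) (h n)" for n
  define est where "est n = 2 * T * ((real n + 1) * B * exp (- k * real n) + 2 * sqrt (e n)) + 2 * B / k\<^sup>2" for n
  define C where "C = 3 * (1 + (norm c + B))\<^sup>2"
  have B: "B \<ge> 0" using order_trans[OF norm_ge_zero c[of "of_real \<alpha>"]] by simp
  have e: "e n > 0" for n by (simp add: e_def)
  have op: "open (half_plane \<theta>)" unfolding half_plane_def by (rule open_halfspace_Re_gt)
  have f1: "deriv f holomorphic_on half_plane \<theta>" using f op by (rule holomorphic_deriv)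
  have opU: "open U" unfolding U_def by (intro open_Collect_less continuous_intros)
  have QU: "Q n \<subseteq> U" for n using \<theta> by (auto simp: Q_def U_def cbox_Pair_eq)
  have cg: "continuous_on U g" "continuous_on U g1"
    unfolding g_def g1_def
    by (rule continuous_on_along[OF f] continuous_on_along[OF f1];
        force intro!: continuous_intros simp: half_plane_def U_def)+
  have pos: "1 + norm w \<noteq> 0" for w :: complex using norm_ge_zero[of w] by linarith
  have ch: "continuous_on (Q n) (h n)" for n
  proof -
    have "sqrt (e n + (norm w)\<^sup>2) > 0" for w :: complex using e[of n] by (simp add: add_pos_nonneg)
    then have "1 + sqrt (e n + (norm w)\<^sup>2) \<noteq> 0" "sqrt (e n + (norm w)\<^sup>2) \<noteq> 0" for w :: complex
      by (metis add_pos_pos less_irrefl zero_less_one, metis less_irrefl)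
    then show ?thesis unfolding h_def lap_reg_def
      by (intro continuous_intros continuous_on_subset[OF cg(1) QU] continuous_on_subset[OF cg(2) QU]) auto
  qed
  have hpos: "h n p \<ge> 0" if "p \<in> Q n" for n p
    using that unfolding h_def by (intro mult_nonneg_nonneg lap_reg_nonneg e) (auto simp: Q_def cbox_Pair_eq)
  have [measurable]: "D n \<in> borel_measurable borel" for n
  proof -
    have "D n = (\<lambda>p. ennreal (indicator (Q n) p *\<^sub>R h n p))"
      by (auto simp: D_def fun_eq_iff indicator_def)
    also have "\<dots> \<in> borel_measurable borel"
      by (intro measurable_compose[OF borel_measurable_continuous_on_indicator[OF _ ch] measurable_ennreal])
         (simp add: Q_def)
    finally show ?thesis .
  qed
  have [measurable]: "D0 \<in> borel_measurable borel"
  proof -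
    \<comment> \<open>The continuity of \<open>g\<close> and \<open>g1\<close> is available only on \<open>U\<close>; cutting them off outside \<open>U\<close>
      does not change \<open>D0\<close>, which vanishes there.\<close>
    have m[measurable]: "(\<lambda>p. indicator U p *\<^sub>R g p) \<in> borel_measurable borel" 
      "(\<lambda>p. indicator U p *\<^sub>R g1 p) \<in> borel_measurable borel"
      using opU by (auto intro!: borel_measurable_continuous_on_indicator cg)
    have [measurable]: "{\<alpha><..} \<times> {-T..T} \<in> sets borel"
      by (simp flip: borel_prod)
    have [measurable]: "(\<lambda>p. fst p - \<alpha>) \<in> borel_measurable (borel :: (real \<times> real) measure)"
      by (intro borel_measurable_continuous_onI continuous_intros)
    have "D0 = (\<lambda>p. ennreal ((norm (indicator U p *\<^sub>R g1 p))\<^sup>2 / (norm (indicator U p *\<^sub>R g p)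
        * (1 + norm (indicator U p *\<^sub>R g p))\<^sup>2) * (fst p - \<alpha>)) * indicator ({\<alpha><..} \<times> {-T..T}) p)"
      using \<theta> by (auto simp: D0_def fun_eq_iff indicator_def lp_density_def g_def g1_def U_def)
    also have "\<dots> \<in> borel_measurable borel" by measurable
    finally show ?thesis .
  qed
  have lp: "lp_integral f \<alpha> T = integral\<^sup>N lborel D0"
    using lp_integral_eq_nn_integral_prod[of f \<alpha> T] \<open>D0 \<in> borel_measurable borel\<close>
    unfolding D0_def by blast
  have intD: "integral\<^sup>N lborel (D n) = ennreal (I n)" for n
    unfolding D_def I_def
    by (intro nn_integral_has_integral_lebesgue' hpos integrable_integral)
       (use ch[of n] in \<open>auto simp: Q_def intro: integrable_continuous\<close>)
  have I0: "I n \<ge> 0" for n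
    unfolding I_def using ch[of n] by (intro integral_nonneg hpos) (auto simp: Q_def intro: integrable_continuous)
  have est: "\<bar>I n - W\<bar> \<le> est n" for n
    using regularised_green_estimate[OF f \<theta> k e[of n] _ T c d, of "\<alpha> + real n"]
    by (simp add: I_def W_def est_def Q_def h_def[abs_def] g_def g1_def case_prod_unfold)
  have est_lim: "est \<longlonglongrightarrow> 2 * B / k\<^sup>2"
    unfolding est_def e_def by (rule estimate_limit[OF k])
  \<comment> \<open>At a simple zero the regularised densities tend to infinity, so a null set has to be removed.\<close>
  have null: "AE p in lborel. p \<in> U \<longrightarrow> g p \<noteq> 0"
  proof -
    have "countable ((\<lambda>s. (Re s, Im s)) ` {s \<in> half_plane \<theta>. f s = 0})" using z by simp
    moreover have "{p \<in> U. g p = 0} \<subseteq> (\<lambda>s. (Re s, Im s)) ` {s \<in> half_plane \<theta>. f s = 0}"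
      by (force simp: U_def g_def half_plane_def image_iff intro!: exI[of _ "Complex _ _"])
    ultimately have "countable {p \<in> U. g p = 0}" by (rule countable_subset[rotated])
    then have "AE p in lborel. p \<notin> {p \<in> U. g p = 0}"
      by (intro AE_not_in countable_imp_null_set_lborel)
    then show ?thesis by eventually_elim auto
  qed
  have conv: "AE p in lborel. (\<lambda>n. D n p) \<longlonglongrightarrow> D0 p"
    using null
  proof eventually_elim
    case (elim p)
    show ?case
    proof (cases "fst p > \<alpha> \<and> snd p \<in> {-T..T}")
      case True
      then have "g p \<noteq> 0" using elim \<theta> by (auto simp: U_def)
      have "eventually (\<lambda>n. p \<in> Q n) sequentially"
      proof -
        have "eventually (\<lambda>n. real n \<ge> fst p - \<alpha>) sequentially"
          using filterlim_real_sequentially by (auto simp: filterlim_at_top)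
        then show ?thesis
          by eventually_elim (use True in \<open>auto simp: Q_def cbox_Pair_eq mem_Times_iff\<close>)
      qed
      then have ev: "eventually (\<lambda>n. ennreal (h n p) = D n p) sequentially"
        by eventually_elim (simp add: D_def)
      have "e \<longlonglongrightarrow> 0" unfolding e_def by (rule LIMSEQ_inverse_real_of_nat)
      from tendsto_mult_left[OF lap_reg_tendsto[OF \<open>g p \<noteq> 0\<close> this, of "g1 p"], of "fst p - \<alpha>"]
      have "(\<lambda>n. ennreal (h n p)) \<longlonglongrightarrow> ennreal (lp_density f (Complex (fst p) (snd p)) * (fst p - \<alpha>))"
        unfolding h_def by (intro tendsto_ennrealI) (simp add: lp_density_def g_def g1_def mult.commute)
      also have "ennreal (lp_density f (Complex (fst p) (snd p)) * (fst p - \<alpha>)) = D0 p"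
        using True by (simp add: D0_def indicator_def mem_Times_iff)
      finally show ?thesis by (rule Lim_transform_eventually[OF _ ev])
    next
      case False
      then have "D n p = 0" for n
        by (cases "fst p = \<alpha>") (auto simp: D_def h_def Q_def cbox_Pair_eq mem_Times_iff indicator_def)
      moreover have "D0 p = 0" using False by (auto simp: D0_def indicator_def mem_Times_iff)
      ultimately show ?thesis by simp
    qed
  qed
  have bound: "AE p in lborel. D n p \<le> ennreal C * D0 p" for n
    using null
  proof eventually_elim
    case (elim p)
    show ?case
    proof (cases "p \<in> Q n \<and> fst p > \<alpha>")
      case True
      then have "g p \<noteq> 0" using elim \<theta> by (auto simp: U_def)
      have "norm (g p) \<le> norm c + B"
      proof -
        have "norm (g p - c) \<le> B * exp (- k * (fst p - \<alpha>))"
          using c[of "Complex (fst p) (snd p)"] True by (simp add: g_def)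
        also have "\<dots> \<le> B * 1" using True k B by (intro mult_left_mono) auto
        finally show ?thesis using norm_triangle_sub[of "g p" c] by simp
      qed
      from lap_reg_le[OF e \<open>g p \<noteq> 0\<close> this, of n "g1 p"]
      have "h n p \<le> (fst p - \<alpha>) * (C * lp_density f (Complex (fst p) (snd p)))"
        unfolding h_def using True by (intro mult_left_mono) (auto simp: C_def lp_density_def g_def g1_def)
      then have "ennreal (h n p) \<le> ennreal (C * (lp_density f (Complex (fst p) (snd p)) * (fst p - \<alpha>)))"
        by (intro ennreal_leI) (simp add: algebra_simps)
      also have "\<dots> = ennreal C * ennreal (lp_density f (Complex (fst p) (snd p)) * (fst p - \<alpha>))"
        by (intro ennreal_mult') (simp add: C_def)
      finally show ?thesis
        using True by (simp add: D_def D0_def indicator_def Q_def cbox_Pair_eq mem_Times_iff)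
    next
      case False
      then have "D n p = 0"
        by (cases "fst p = \<alpha>") (auto simp: D_def h_def Q_def cbox_Pair_eq mem_Times_iff indicator_def)
      then show ?thesis by simp
    qed
  qed
  \<comment> \<open>The domination below is by a multiple of \<open>D0\<close> itself, so finiteness must come first;
    Fatou's lemma obtains it from the bounded integrals of \<open>D n\<close>.\<close>
  have fin: "integral\<^sup>N lborel D0 < \<infinity>"
  proof -
    obtain K where K: "\<And>n. \<bar>est n\<bar> \<le> K"
      using convergent_imp_Bseq[OF convergentI[OF est_lim]] by (auto simp: Bseq_def)
    have "integral\<^sup>N lborel D0 = (\<integral>\<^sup>+p. liminf (\<lambda>n. D n p) \<partial>lborel)"
      using conv by (intro nn_integral_cong_AE, eventually_elim) (metis tendsto_iff_Liminf_eq_Limsup sequentially_bot)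
    also have "\<dots> \<le> liminf (\<lambda>n. integral\<^sup>N lborel (D n))" by (intro nn_integral_liminf) simp
    also have "\<dots> \<le> liminf (\<lambda>n. ennreal (W + K))"
    proof (intro Liminf_mono always_eventually allI)
      fix n
      have "I n \<le> W + K" using est[of n] K[of n] by linarith
      then show "integral\<^sup>N lborel (D n) \<le> ennreal (W + K)" unfolding intD by (rule ennreal_leI)
    qed
    also have "\<dots> = ennreal (W + K)" by (simp add: Liminf_const)
    also have "\<dots> < \<infinity>" by simp
    finally show ?thesis .
  qed
  then obtain R where R: "R \<ge> 0" "integral\<^sup>N lborel D0 = ennreal R"
    by (cases "integral\<^sup>N lborel D0") auto
  have "(\<lambda>n. integral\<^sup>N lborel (D n)) \<longlonglongrightarrow> integral\<^sup>N lborel D0"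
  proof (rule nn_integral_dominated_convergence[OF _ _ _ bound _ conv])
    have "(\<integral>\<^sup>+p. ennreal C * D0 p \<partial>lborel) = ennreal C * integral\<^sup>N lborel D0"
      by (intro nn_integral_cmult) simp
    also have "\<dots> < \<infinity>" using fin by (simp add: ennreal_mult_less_top)
    finally show "(\<integral>\<^sup>+p. ennreal C * D0 p \<partial>lborel) < \<infinity>" .
  qed simp_all
  then have "I \<longlonglongrightarrow> R" unfolding intD R(2) using I0 R(1) by (subst (asm) tendsto_ennreal_iff) auto
  then have "(\<lambda>n. \<bar>I n - W\<bar>) \<longlonglongrightarrow> \<bar>R - W\<bar>" by (intro tendsto_intros)
  from LIMSEQ_le[OF this est_lim] have "\<bar>R - W\<bar> \<le> 2 * B / k\<^sup>2" using est by blast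
  then show ?thesis using R lp by (auto simp: W_def)
qed

section \<open>Uniformly almost periodic functions and their means\<close>

text \<open>
  The uniform closure of the trigonometric polynomials, which is Bohr's class of almost periodic
  functions. The inductive form reduces every closure property to characters, sums and
  uniform limits.
\<close>
inductive almost_periodic :: "(real \<Rightarrow> complex) \<Rightarrow> bool" where
  character: "almost_periodic (\<lambda>t. c * exp (\<i> * of_real (l * t)))"
| add: "almost_periodic g \<Longrightarrow> almost_periodic h \<Longrightarrow> almost_periodic (\<lambda>t. g t + h t)"
| limit: "(\<And>n. almost_periodic (h n)) \<Longrightarrow> uniform_limit UNIV h g sequentially \<Longrightarrow> almost_periodic g"

lemma almost_periodic_continuous: "almost_periodic g \<Longrightarrow> continuous_on UNIV g"
proof (induction rule: almost_periodic.induct)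
  case (limit h g)
  show ?case
    by (rule uniform_limit_theorem[OF always_eventually[OF allI[OF limit(3)]] limit(2)]) simp
qed (auto intro!: continuous_intros)

lemma almost_periodic_bounded: "almost_periodic g \<Longrightarrow> \<exists>B>0. \<forall>t. norm (g t) \<le> B"
proof (induction rule: almost_periodic.induct)
  case (character c l)
  then show ?case
    by (intro exI[of _ "norm c + 1"]) (auto simp: norm_mult norm_exp_eq_Re add_nonneg_pos)
next
  case (add g h)
  then obtain B C where "B > 0" "\<forall>t. norm (g t) \<le> B" "C > 0" "\<forall>t. norm (h t) \<le> C" by blast
  then show ?case
    by (intro exI[of _ "B + C"]) (auto intro!: norm_triangle_mono)
next
  case (limit h g)
  obtain n where n: "\<forall>t. dist (h n t) (g t) < 1"
    using uniform_limitD[OF limit(2), of 1] by (auto simp: eventually_sequentially)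
  obtain B where B: "B > 0" "\<forall>t. norm (h n t) \<le> B" using limit(3)[of n] by blast
  have "norm (g t) \<le> B + 1" for t
    using n[rule_format, of t] B(2)[rule_format, of t] norm_triangle_ineq2[of "g t" "h n t"]
    by (simp add: dist_norm norm_minus_commute)
  then show ?case using B by (intro exI[of _ "B + 1"]) auto
qed

lemma almost_periodic_const: "almost_periodic (\<lambda>t. c)"
  using almost_periodic.character[of c 0] by simp

lemma almost_periodic_sum:
  "(\<And>x. x \<in> A \<Longrightarrow> almost_periodic (g x)) \<Longrightarrow> almost_periodic (\<lambda>t. \<Sum>x\<in>A. g x t)"
  by (induction A rule: infinite_finite_induct)
     (auto intro: almost_periodic_const almost_periodic.add)

lemma almost_periodic_mult:
  assumes "almost_periodic g" "almost_periodic h"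
  shows "almost_periodic (\<lambda>t. g t * h t)"
  using assms(1)
proof (induction rule: almost_periodic.induct)
  case (character c l)
  show ?case using assms(2)
  proof (induction rule: almost_periodic.induct)
    case (character d k)
    have "(\<lambda>t. c * exp (\<i> * of_real (l * t)) * (d * exp (\<i> * of_real (k * t)))) =
        (\<lambda>t. (c * d) * exp (\<i> * of_real ((l + k) * t)))"
      by (simp add: fun_eq_iff algebra_simps exp_add)
    then show ?case using almost_periodic.character[of "c*d" "l+k"] by simp
  next
    case (add g h)
    then show ?case by (simp add: distrib_left almost_periodic.add)
  next
    case (limit h g)
    show ?case
    proof (rule almost_periodic.limit[OF limit(3)])
      have "bounded (range g)"
        using almost_periodic_bounded[OF almost_periodic.limit[OF limit(1,2)]]
        by (auto simp: bounded_iff)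
      moreover have "bounded (range (\<lambda>t. c * exp (\<i> * of_real (l * t))))"
        using almost_periodic_bounded[OF almost_periodic.character[of c l]]
        by (auto simp: bounded_iff)
      ultimately show "uniform_limit UNIV (\<lambda>n t. c * exp (\<i> * of_real (l * t)) * h n t)
          (\<lambda>t. c * exp (\<i> * of_real (l * t)) * g t) sequentially"
        by (intro uniform_lim_mult uniform_limit_const limit(2))
    qed
  qed
next
  case (add g g')
  then show ?case by (simp add: distrib_right almost_periodic.add)
next
  case (limit k g)
  show ?case
  proof (rule almost_periodic.limit[OF limit(3)])
    have "bounded (range g)"
      using almost_periodic_bounded[OF almost_periodic.limit[OF limit(1,2)]]
      by (auto simp: bounded_iff)
    moreover have "bounded (range h)"
      using almost_periodic_bounded[OF assms(2)] by (auto simp: bounded_iff)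
    ultimately show "uniform_limit UNIV (\<lambda>n t. k n t * h t) (\<lambda>t. g t * h t) sequentially"
      by (intro uniform_lim_mult uniform_limit_const limit(2))
  qed
qed

lemma almost_periodic_cnj: "almost_periodic g \<Longrightarrow> almost_periodic (\<lambda>t. cnj (g t))"
proof (induction rule: almost_periodic.induct)
  case (character c l)
  have "(\<lambda>t. cnj (c * exp (\<i> * of_real (l * t)))) = (\<lambda>t. cnj c * exp (\<i> * of_real ((-l) * t)))"
    by (simp add: fun_eq_iff exp_cnj)
  then show ?case using almost_periodic.character[of "cnj c" "-l"] by simp
next
  case (add g h)
  then show ?case by (simp add: almost_periodic.add)
next
  case (limit h g)
  show ?case
    by (rule almost_periodic.limit[OF limit(3)])
       (rule bounded_linear.uniform_limit[OF bounded_linear_cnj limit(2)])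
qed

text \<open>
  A real linear form on the complex numbers is a combination of \<open>z\<close> and \<open>cnj z\<close>; everything else
  is closure under sums and products.
\<close>
lemma almost_periodic_polynomial:
  assumes "real_polynomial_function p" "almost_periodic g"
  shows "almost_periodic (\<lambda>t. of_real (p (g t)))"
  using assms(1)
proof (induction rule: real_polynomial_function.induct)
  case (linear p)
  interpret bounded_linear p by fact
  have p: "p z = p 1 * Re z + p \<i> * Im z" for z
  proof -
    have "z = Re z *\<^sub>R 1 + Im z *\<^sub>R \<i>" by (simp add: complex_eq_iff)
    then have "p z = p (Re z *\<^sub>R 1 + Im z *\<^sub>R \<i>)" by simp
    also have "\<dots> = p 1 * Re z + p \<i> * Im z" by (simp only: add scaleR) simp
    finally show ?thesis .
  qed
  have "(\<lambda>t. of_real (p (g t))) =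
      (\<lambda>t. ((p 1 - \<i> * p \<i>) / 2) * g t + ((p 1 + \<i> * p \<i>) / 2) * cnj (g t))"
    unfolding fun_eq_iff p[of "g _"] by (auto simp: complex_eq_iff field_simps)
  moreover have "almost_periodic (\<lambda>t. ((p 1 - \<i> * p \<i>) / 2) * g t + ((p 1 + \<i> * p \<i>) / 2) * cnj (g t))"
    by (rule almost_periodic.add; rule almost_periodic_mult)
       (rule almost_periodic_const almost_periodic_cnj assms(2))+
  ultimately show ?case by (rule back_subst[of almost_periodic, OF _ sym, rotated])
next
  case (const c)
  then show ?case by (rule almost_periodic_const)
next
  case (add p q)
  then show ?case by (simp add: almost_periodic.add)
next
  case (mult p q)
  then show ?case by (simp add: almost_periodic_mult)
qed

text \<open>
  The range of an almost periodic function is bounded, and on a disc containing it \<open>\<phi>\<close> is a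
  uniform limit of polynomials in the real and imaginary parts.
\<close>
lemma almost_periodic_compose:
  fixes \<phi> :: "complex \<Rightarrow> real"
  assumes "almost_periodic g" "continuous_on UNIV \<phi>"
  shows "almost_periodic (\<lambda>t. of_real (\<phi> (g t)))"
proof -
  obtain B where B: "\<forall>t. norm (g t) \<le> B" using almost_periodic_bounded[OF assms(1)] by blast
  have "\<exists>p. real_polynomial_function p \<and> (\<forall>z\<in>cball 0 B. \<bar>\<phi> z - p z\<bar> < inverse (real (Suc n)))" for n
  proof -
    obtain p where "real_polynomial_function p" "\<And>z. z \<in> cball 0 B \<Longrightarrow> \<bar>\<phi> z - p z\<bar> < inverse (real (Suc n))"
      using Stone_Weierstrass_real_polynomial_function[of "cball 0 B" \<phi> "inverse (real (Suc n))"]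
        continuous_on_subset[OF assms(2)] by auto
    then show ?thesis by blast
  qed
  then obtain p where p: "\<And>n. real_polynomial_function (p n)"
    "\<And>n z. z \<in> cball 0 B \<Longrightarrow> \<bar>\<phi> z - p n z\<bar> < inverse (real (Suc n))" by metis
  show ?thesis
  proof (rule almost_periodic.limit[OF almost_periodic_polynomial[OF p(1) assms(1)]])
    show "uniform_limit UNIV (\<lambda>n t. of_real (p n (g t)) :: complex) (\<lambda>t. of_real (\<phi> (g t))) sequentially"
    proof (rule uniform_limitI)
      fix e :: real assume "e > 0"
      have "dist (of_real (p n (g t)) :: complex) (of_real (\<phi> (g t))) < inverse (real (Suc n))" for n t
        using p(2)[of "g t" n] B by (simp add: dist_of_real dist_real_def abs_minus_commute)
      moreover have "eventually (\<lambda>n. inverse (real (Suc n)) < e) sequentially"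
        using LIMSEQ_inverse_real_of_nat \<open>e > 0\<close> by (rule order_tendstoD)
      ultimately show "\<forall>\<^sub>F n in sequentially. \<forall>t\<in>UNIV. dist (of_real (p n (g t)) :: complex) (of_real (\<phi> (g t))) < e"
        by (auto elim!: eventually_mono intro: less_trans)
    qed
  qed
qed

lemma norm_mean_le:
  fixes g :: "real \<Rightarrow> complex"
  assumes "continuous_on UNIV g" "\<And>t. norm (g t) \<le> e" "T > 0"
  shows "norm (of_real (1 / (2 * T)) * integral {-T..T} g) \<le> e"
proof -
  have "norm (integral {-T..T} g) \<le> e * (T - (-T))"
    using assms by (intro integral_bound) (auto intro: continuous_on_subset)
  then show ?thesis using assms(3) by (simp add: norm_mult norm_divide field_simps)
qed

lemma character_mean:
  "\<exists>m. ((\<lambda>T. of_real (1 / (2 * T)) * integral {-T..T} (\<lambda>t. c * exp (\<i> * of_real (l * t)))) \<longlongrightarrow> m) at_top"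
proof (cases "l = 0")
  case True
  have "eventually (\<lambda>T. of_real (1 / (2 * T)) * integral {-T..T} (\<lambda>t. c * exp (\<i> * of_real (l * t))) = c) at_top"
    using eventually_gt_at_top[of "0::real"] by eventually_elim (simp add: True scaleR_conv_of_real)
  then show ?thesis by (intro exI[of _ c] tendsto_eventually)
next
  case False
  let ?F = "\<lambda>t. c * exp (\<i> * of_real (l * t)) / (\<i> * of_real l)"
  have I: "integral {-T..T} (\<lambda>t. c * exp (\<i> * of_real (l * t))) = ?F T - ?F (-T)" if "T > 0" for T
    using False that
    by (intro integral_unique fundamental_theorem_of_calculus)
       (auto intro!: derivative_eq_intros has_vector_derivative_real_field
             simp: field_simps)
  have F: "norm (?F t) \<le> norm c / \<bar>l\<bar>" for t
    by (simp add: norm_mult norm_divide norm_exp_eq_Re)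
  have "((\<lambda>T. norm c / \<bar>l\<bar> * inverse T) \<longlongrightarrow> norm c / \<bar>l\<bar> * 0) at_top"
    by (intro tendsto_mult tendsto_const tendsto_inverse_0_at_top filterlim_ident)
  then have "((\<lambda>T. norm c / \<bar>l\<bar> * inverse T) \<longlongrightarrow> 0) at_top" by simp
  moreover have "eventually (\<lambda>T. norm (of_real (1 / (2 * T)) * integral {-T..T} (\<lambda>t. c * exp (\<i> * of_real (l * t))))
     \<le> norm c / \<bar>l\<bar> * inverse T) at_top"
    using eventually_gt_at_top[of "0::real"]
  proof eventually_elim
    case (elim T)
    have "norm (?F T - ?F (-T)) \<le> norm c / \<bar>l\<bar> + norm c / \<bar>l\<bar>"
      by (rule order_trans[OF norm_triangle_ineq4 add_mono[OF F F]])
    then have "norm (?F T - ?F (-T)) / (2 * T) \<le> (norm c / \<bar>l\<bar> + norm c / \<bar>l\<bar>) / (2 * T)"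
      using elim by (intro divide_right_mono) auto
    also have "\<dots> = norm c / \<bar>l\<bar> * inverse T" by (simp add: field_simps)
    finally show ?case unfolding I[OF elim] using elim by (simp add: norm_mult norm_divide)
  qed
  ultimately show ?thesis by (intro exI[of _ 0]) (rule Lim_null_comparison)
qed

text \<open>
  For uniform limits: the averages of \<open>g\<close> and \<open>h n\<close> over \<open>[-T, T]\<close> differ by at most
  \<open>sup \<bar>g - h n\<bar>\<close> for every \<open>T\<close>, so the averages of \<open>g\<close> inherit the Cauchy property.
\<close>
lemma almost_periodic_mean:
  "almost_periodic g \<Longrightarrow> \<exists>m. ((\<lambda>T. of_real (1 / (2 * T)) * integral {-T..T} g) \<longlongrightarrow> m) at_top"
proof (induction rule: almost_periodic.induct)
  case (character c l)
  show ?case by (rule character_mean)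
next
  case (add g h)
  then obtain m k where m: "((\<lambda>T. of_real (1 / (2 * T)) * integral {-T..T} g) \<longlongrightarrow> m) at_top"
    "((\<lambda>T. of_real (1 / (2 * T)) * integral {-T..T} h) \<longlongrightarrow> k) at_top" by blast
  have "integral {-T..T} (\<lambda>t. g t + h t) = integral {-T..T} g + integral {-T..T} h" for T
    using add by (intro integral_add integrable_continuous_real continuous_on_subset[OF almost_periodic_continuous]) auto
  then show ?case using tendsto_add[OF m] by (auto simp: algebra_simps)
next
  case (limit h g)
  let ?M = "\<lambda>k T. complex_of_real (1 / (2 * T)) * integral {-T..T} k"
  have cg: "continuous_on UNIV g"
    by (intro almost_periodic_continuous almost_periodic.limit[OF limit(1,2)])
  have ch: "continuous_on UNIV (h n)" for n by (intro almost_periodic_continuous limit)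
  have diff: "norm (?M g T - ?M (h n) T) \<le> e"
    if "T > 0" "\<And>t. dist (h n t) (g t) \<le> e" for T n e
  proof -
    have "?M g T - ?M (h n) T = ?M (\<lambda>t. g t - h n t) T"
      by (subst integral_diff)
         (auto intro!: integrable_continuous_real continuous_on_subset[OF cg] continuous_on_subset[OF ch]
               simp: algebra_simps)
    also have "norm \<dots> \<le> e"
      using that by (intro norm_mean_le continuous_intros ch cg) (auto simp: dist_norm norm_minus_commute)
    finally show ?thesis .
  qed
  have "\<exists>m. (?M g \<longlongrightarrow> m) at_top"
  proof -
    have "cauchy_filter (filtermap (?M g) at_top)"
      unfolding cauchy_filter_metric_filtermap
    proof (intro allI impI)
      fix e :: real assume "e > 0"
      then obtain n where n: "\<forall>t. dist (h n t) (g t) < e/4"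
        using uniform_limitD[OF limit(2), of "e/4"] by (auto simp: eventually_sequentially)
      obtain m where m: "(?M (h n) \<longlongrightarrow> m) at_top" using limit(3)[of n] by blast
      define P where "P T \<longleftrightarrow> T > 0 \<and> dist (?M (h n) T) m < e/4" for T
      have "eventually P at_top"
        unfolding P_def using \<open>e > 0\<close> by (intro eventually_conj eventually_gt_at_top tendstoD[OF m]) auto
      moreover have near: "dist (?M g T) m < e/2" if "P T" for T
      proof -
        have "dist (?M g T) (?M (h n) T) \<le> e/4"
          using diff[of T n "e/4"] n that by (auto simp: P_def dist_norm intro: less_imp_le)
        then show ?thesis using that dist_triangle[of "?M g T" m "?M (h n) T"] by (simp add: P_def)
      qed
      have "dist (?M g T) (?M g T') < e" if "P T" "P T'" for T T'
        using near[OF that(1)] near[OF that(2)] dist_triangle2[of "?M g T" "?M g T'" m] by simp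
      ultimately show "\<exists>P. eventually P at_top \<and> (\<forall>x y. P x \<and> P y \<longrightarrow> dist (?M g x) (?M g y) < e)"
        by blast
    qed
    then have "\<exists>m\<in>UNIV. filtermap (?M g) at_top \<le> nhds m"
      using complete_uniform[of "UNIV :: complex set"] complete_UNIV
      by (auto simp: trivial_limit_at_top_linorder filtermap_bot_iff)
    then show ?thesis by (auto simp: filterlim_def)
  qed
  then show ?case .
qed

lemma mean_value_tendsto:
  fixes \<phi> :: "complex \<Rightarrow> real"
  assumes "almost_periodic g" "continuous_on UNIV \<phi>"
  shows "((\<lambda>T. 1 / (2 * T) * integral {-T..T} (\<lambda>t. \<phi> (g t))) \<longlongrightarrow> mean_value (\<lambda>t. \<phi> (g t))) at_top"
proof -
  have ap: "almost_periodic (\<lambda>t. of_real (\<phi> (g t)))" using almost_periodic_compose[OF assms] .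
  obtain m where m: "((\<lambda>T. complex_of_real (1 / (2 * T)) * integral {-T..T} (\<lambda>t. of_real (\<phi> (g t)))) \<longlongrightarrow> m) at_top"
    using almost_periodic_mean[OF ap] by blast
  have cont: "continuous_on A (\<lambda>t. \<phi> (g t))" for A
    by (rule continuous_on_compose2[OF assms(2) continuous_on_subset[OF almost_periodic_continuous[OF assms(1)]]])
       simp_all
  have "integral {-T..T} (\<lambda>t. complex_of_real (\<phi> (g t))) = of_real (integral {-T..T} (\<lambda>t. \<phi> (g t)))" for T
    using integral_linear[OF integrable_continuous_real[OF cont, of "-T" T]
        bounded_linear_of_real[where 'a = complex]]
    unfolding o_def .
  then have "Re (complex_of_real (1 / (2 * T)) * integral {-T..T} (\<lambda>t. of_real (\<phi> (g t)))) =
      1 / (2 * T) * integral {-T..T} (\<lambda>t. \<phi> (g t))" for T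
    by (simp only: Re_complex_of_real flip: of_real_mult)
  then have "((\<lambda>T. 1 / (2 * T) * integral {-T..T} (\<lambda>t. \<phi> (g t))) \<longlongrightarrow> Re m) at_top"
    using tendsto_Re[OF m] by (simp only:)
  then show ?thesis unfolding mean_value_def
    by (simp add: tendsto_Lim[OF trivial_limit_at_top_linorder])
qed

section \<open>Dirichlet series with nonpositive abscissa of uniform convergence\<close>

lemma open_half_plane: "open (half_plane \<theta>)"
  unfolding half_plane_def by (rule open_halfspace_Re_gt)

lemma norm_of_nat_powr: "norm (of_nat (Suc n) powr (- s) :: complex) = real (Suc n) powr (- Re s)"
  by (subst norm_powr_real_powr) auto

lemma sums_dirichlet_partial_sum:
  "(\<lambda>N. dirichlet_partial_sum a N s) \<longlonglongrightarrow> l \<longleftrightarrow> (\<lambda>n. a (Suc n) * of_nat (Suc n) powr (- s)) sums l"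
  unfolding sums_def dirichlet_partial_sum_def One_nat_def sum.atLeast1_atMost_eq ..

lemma uniform_limit_dirichlet:
  assumes "abscissa_unif a \<le> 0" "\<theta> > 0"
  shows "uniform_limit (half_plane \<theta>) (dirichlet_partial_sum a) (dirichlet_fun a) sequentially"
proof -
  have "abscissa_unif a < ereal \<theta>" using assms by (simp add: order.strict_trans1)
  then obtain \<theta>' where \<theta>': "\<theta>' < \<theta>" "uniformly_convergent_on (half_plane \<theta>') (dirichlet_partial_sum a)"
    by (auto simp: abscissa_unif_def Inf_less_iff)
  then obtain l where "uniform_limit (half_plane \<theta>') (dirichlet_partial_sum a) l sequentially"
    by (auto simp: uniformly_convergent_on_def)
  then have l: "uniform_limit (half_plane \<theta>) (dirichlet_partial_sum a) l sequentially"
    by (rule uniform_limit_on_subset) (use \<theta>' in \<open>auto simp: half_plane_def\<close>)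
  have "l s = dirichlet_fun a s" if "s \<in> half_plane \<theta>" for s
    using tendsto_uniform_limitI[OF l that]
    unfolding sums_dirichlet_partial_sum dirichlet_fun_def by (rule sums_unique)
  then show ?thesis using l by (subst uniform_limit_cong'[where g = "dirichlet_partial_sum a" and i = l]) auto
qed

lemma dirichlet_sums:
  assumes "abscissa_unif a \<le> 0" "Re s > 0"
  shows "(\<lambda>n. a (Suc n) * of_nat (Suc n) powr (- s)) sums dirichlet_fun a s"
  unfolding sums_dirichlet_partial_sum[symmetric]
  by (rule tendsto_uniform_limitI[OF uniform_limit_dirichlet[OF assms(1), of "Re s / 2"]])
     (use assms in \<open>auto simp: half_plane_def\<close>)

lemma dirichlet_holomorphic:
  assumes "abscissa_unif a \<le> 0"
  shows "dirichlet_fun a holomorphic_on half_plane 0"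
proof (rule holomorphic_uniform_sequence[OF open_half_plane])
  show "dirichlet_partial_sum a N holomorphic_on half_plane 0" for N
    unfolding dirichlet_partial_sum_def[abs_def] by (auto intro!: holomorphic_intros)
  fix z assume z: "z \<in> half_plane 0"
  have sub: "cball z (Re z / 2) \<subseteq> half_plane (Re z / 4)"
  proof
    fix w assume "w \<in> cball z (Re z / 2)"
    then have "Re z - Re w \<le> Re z / 2" using complex_Re_le_cmod[of "z - w"] by (simp add: dist_norm)
    then have "Re z / 4 < Re w" using z unfolding half_plane_def mem_Collect_eq by linarith
    then show "w \<in> half_plane (Re z / 4)" by (simp add: half_plane_def)
  qed
  moreover have "half_plane (Re z / 4) \<subseteq> half_plane 0" using z by (auto simp: half_plane_def)
  moreover have "uniform_limit (cball z (Re z / 2)) (dirichlet_partial_sum a) (dirichlet_fun a) sequentially"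
    by (rule uniform_limit_on_subset[OF uniform_limit_dirichlet[OF assms] sub]) (use z in \<open>simp add: half_plane_def\<close>)
  ultimately show "\<exists>d>0. cball z d \<subseteq> half_plane 0 \<and>
      uniform_limit (cball z d) (dirichlet_partial_sum a) (dirichlet_fun a) sequentially"
    using z by (intro exI[of _ "Re z / 2"]) (auto simp: half_plane_def)
qed

lemma dirichlet_bounded:
  assumes "abscissa_unif a \<le> 0" "\<theta> > 0"
  shows "\<exists>M. \<forall>s\<in>half_plane \<theta>. norm (dirichlet_fun a s) \<le> M"
proof -
  obtain N where N: "\<forall>s\<in>half_plane \<theta>. dist (dirichlet_partial_sum a N s) (dirichlet_fun a s) < 1"
    using uniform_limitD[OF uniform_limit_dirichlet[OF assms], of 1] by (auto simp: eventually_sequentially)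
  have "norm (dirichlet_fun a s) \<le> (\<Sum>n=1..N. norm (a n)) + 1" if s: "s \<in> half_plane \<theta>" for s
  proof -
    have "norm (dirichlet_partial_sum a N s) \<le> (\<Sum>n=1..N. norm (a n))"
      unfolding dirichlet_partial_sum_def
    proof (rule sum_norm_le)
      fix n assume "n \<in> {1..N}"
      then obtain m where m: "n = Suc m" by (cases n) auto
      have "real (Suc m) powr (- Re s) \<le> real (Suc m) powr 0"
        using s assms by (intro powr_mono) (auto simp: half_plane_def)
      then have "norm (a n) * real (Suc m) powr (- Re s) \<le> norm (a n) * 1"
        by (intro mult_left_mono) auto
      then show "norm (a n * of_nat n powr (- s)) \<le> norm (a n)"
        unfolding norm_mult m norm_of_nat_powr by simp
    qed
    then show ?thesis using N s norm_triangle_sub[of "dirichlet_fun a s" "dirichlet_partial_sum a N s"]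
      by (force simp: dist_norm norm_minus_commute)
  qed
  then show ?thesis by blast
qed

text \<open>
  The terms of the convergent series at the point \<open>\<theta>\<close> are bounded.
\<close>
lemma dirichlet_coefficient_bound:
  assumes "abscissa_unif a \<le> 0" "\<theta> > 0"
  shows "\<exists>K\<ge>0. \<forall>n. norm (a (Suc n)) \<le> K * real (Suc n) powr \<theta>"
proof -
  have "summable (\<lambda>n. a (Suc n) * of_nat (Suc n) powr (- of_real \<theta>))"
    using dirichlet_sums[OF assms(1), of "of_real \<theta>"] assms(2) by (auto intro: sums_summable)
  then have "Bseq (\<lambda>n. a (Suc n) * of_nat (Suc n) powr (- of_real \<theta>))"
    by (intro convergent_imp_Bseq convergentI[OF summable_LIMSEQ_zero])
  then obtain K where K: "K > 0" "\<And>n. norm (a (Suc n) * of_nat (Suc n) powr (- of_real \<theta>)) \<le> K"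
    by (auto simp: Bseq_def)
  have "norm (a (Suc n)) \<le> K * real (Suc n) powr \<theta>" for n
  proof -
    have "norm (a (Suc n)) * real (Suc n) powr (- \<theta>) \<le> K"
      using K(2)[of n] unfolding norm_mult norm_of_nat_powr by simp
    then show ?thesis by (simp add: powr_minus field_simps)
  qed
  then show ?thesis using K(1) by (intro exI[of _ K]) auto
qed

text \<open>
  For \<open>Re s \<ge> \<theta> + 2\<close> the series converges absolutely and, beyond its first term, each term is at
  most \<open>K 2 powr (\<theta> + 2 - Re s) / n\<^sup>2\<close>; in the remaining strip \<open>2 powr - Re s\<close> is bounded below
  and the boundedness of the sum is enough.
\<close>
lemma dirichlet_decay:
  assumes a: "abscissa_unif a \<le> 0" and \<alpha>: "\<alpha> > 0"
  shows "\<exists>B\<ge>0. \<forall>s. Re s \<ge> \<alpha> \<longrightarrow> norm (dirichlet_fun a s - a 1) \<le> B * 2 powr (- (Re s))"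
proof -
  define \<theta> where "\<theta> = \<alpha> / 2"
  have \<theta>: "\<theta> > 0" "\<theta> < \<alpha>" using \<alpha> by (auto simp: \<theta>_def)
  obtain K where K: "K \<ge> 0" "\<And>n. norm (a (Suc n)) \<le> K * real (Suc n) powr \<theta>"
    using dirichlet_coefficient_bound[OF a \<theta>(1)] by blast
  obtain M where M: "\<And>s. s \<in> half_plane \<theta> \<Longrightarrow> norm (dirichlet_fun a s) \<le> M"
    using dirichlet_bounded[OF a \<theta>(1)] by blast
  define Z where "Z = (\<Sum>n. real (Suc (Suc n)) powr (-2))"
  have Zs: "summable (\<lambda>n. real (Suc (Suc n)) powr (-2))"
    using summable_Suc_iff[of "\<lambda>n. real (Suc n) powr (-2)"] summable_Suc_iff[of "\<lambda>n. real n powr (-2)"]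
      summable_real_powr_iff[of "-2"] by simp
  have Z: "Z \<ge> 0" unfolding Z_def by (intro suminf_nonneg Zs) auto
  have far: "norm (dirichlet_fun a s - a 1) \<le> K * Z * 2 powr (\<theta> + 2) * 2 powr (- Re s)" if s: "Re s \<ge> \<theta> + 2" for s
  proof -
    let ?t = "\<lambda>n. a (Suc n) * of_nat (Suc n) powr (- s)"
    have "?t sums dirichlet_fun a s" using dirichlet_sums[OF a] s \<theta> by simp
    then have tail: "(\<lambda>n. ?t (Suc n)) sums (dirichlet_fun a s - a 1)"
      by (subst sums_Suc_iff) simp
    have bd: "norm (?t (Suc n)) \<le> K * 2 powr (\<theta> + 2 - Re s) * real (Suc (Suc n)) powr (-2)" for n
    proof -
      have "norm (?t (Suc n)) = norm (a (Suc (Suc n))) * real (Suc (Suc n)) powr (- Re s)"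
        unfolding norm_mult norm_of_nat_powr ..
      also have "\<dots> \<le> K * real (Suc (Suc n)) powr \<theta> * real (Suc (Suc n)) powr (- Re s)"
        by (intro mult_right_mono K) auto
      also have "\<dots> = K * (real (Suc (Suc n)) powr (\<theta> + 2 - Re s) * real (Suc (Suc n)) powr (-2))"
        unfolding mult.assoc powr_add[symmetric] by simp
      also have "\<dots> \<le> K * (2 powr (\<theta> + 2 - Re s) * real (Suc (Suc n)) powr (-2))"
        using s by (intro mult_left_mono mult_right_mono powr_mono2' K) auto
      finally show ?thesis by (simp add: mult.assoc)
    qed
    have "norm (dirichlet_fun a s - a 1) \<le> (\<Sum>n. K * 2 powr (\<theta> + 2 - Re s) * real (Suc (Suc n)) powr (-2))"
      unfolding sums_unique[OF tail] by (intro norm_suminf_le bd summable_mult Zs)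
    also have "\<dots> = K * 2 powr (\<theta> + 2 - Re s) * Z" unfolding Z_def by (intro suminf_mult Zs)
    also have "2 powr (\<theta> + 2 - Re s) = 2 powr (\<theta> + 2) * 2 powr (- Re s)" by (simp flip: powr_add)
    finally show ?thesis by (simp add: mult_ac)
  qed
  have M0: "M \<ge> 0" using M[of "of_real \<alpha>"] \<theta> norm_ge_zero[of "dirichlet_fun a (of_real \<alpha>)"]
    by (simp add: half_plane_def del: norm_ge_zero)
  have near: "norm (dirichlet_fun a s - a 1) \<le> (M + norm (a 1)) * 2 powr (\<theta> + 2) * 2 powr (- Re s)"
    if s: "Re s \<ge> \<alpha>" "Re s \<le> \<theta> + 2" for s
  proof -
    have "norm (dirichlet_fun a s - a 1) \<le> (M + norm (a 1)) * 1"
      using M[of s] s \<theta> norm_triangle_ineq4[of "dirichlet_fun a s" "a 1"] by (simp add: half_plane_def)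
    also have "\<dots> \<le> (M + norm (a 1)) * (2 powr (\<theta> + 2) * 2 powr (- Re s))"
      using s M0 by (intro mult_left_mono) (auto simp flip: powr_add intro!: ge_one_powr_ge_zero)
    finally show ?thesis by (simp add: mult.assoc)
  qed
  let ?B = "(K * Z + (M + norm (a 1))) * 2 powr (\<theta> + 2)"
  have "norm (dirichlet_fun a s - a 1) \<le> ?B * 2 powr (- Re s)" if "Re s \<ge> \<alpha>" for s
  proof -
    have "0 \<le> K * Z * 2 powr (\<theta> + 2) * 2 powr (- Re s)" "0 \<le> (M + norm (a 1)) * 2 powr (\<theta> + 2) * 2 powr (- Re s)"
      using K Z M0 by auto
    then show ?thesis
      using near[OF that] far[of s] by (cases "Re s \<le> \<theta> + 2") (auto simp: distrib_right)
  qed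
  moreover have "?B \<ge> 0" using K Z M0 by auto
  ultimately show ?thesis by blast
qed

text \<open>
  The decay of \<open>f - a 1\<close> carries over to \<open>f'\<close> by Cauchy's inequality on discs of the fixed
  radius \<open>\<alpha> / 2\<close>, which stay in a half plane where the decay is known.
\<close>
lemma dirichlet_decay_deriv:
  assumes a: "abscissa_unif a \<le> 0" and \<alpha>: "\<alpha> > 0"
  shows "\<exists>B. \<forall>s. Re s \<ge> \<alpha> \<longrightarrow>
     norm (dirichlet_fun a s - a 1) \<le> B * exp (- ln 2 * (Re s - \<alpha>)) \<and>
     norm (deriv (dirichlet_fun a) s) \<le> B * exp (- ln 2 * (Re s - \<alpha>))"
proof -
  define r where "r = \<alpha> / 2"
  have r: "r > 0" "r < \<alpha>" using \<alpha> by (auto simp: r_def)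
  obtain B where B: "B \<ge> 0" "\<And>s. Re s \<ge> r \<Longrightarrow> norm (dirichlet_fun a s - a 1) \<le> B * 2 powr (- Re s)"
    using dirichlet_decay[OF a r(1)] by blast
  have hol: "(\<lambda>s. dirichlet_fun a s - a 1) holomorphic_on half_plane 0"
    by (intro holomorphic_intros dirichlet_holomorphic a)
  have B1: "norm (dirichlet_fun a s - a 1) \<le> B * 2 powr (- Re s)" if "Re s \<ge> \<alpha>" for s
    using B(2)[of s] that r by simp
  have B2: "norm (deriv (dirichlet_fun a) s) \<le> B * 2 powr r / r * 2 powr (- Re s)" if s: "Re s \<ge> \<alpha>" for s
  proof -
    have Re: "Re w \<ge> Re s - r" if "dist s w \<le> r" for w
      using abs_Re_le_cmod[of "s - w"] that by (simp add: dist_norm)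
    have sub: "cball s r \<subseteq> half_plane 0"
    proof
      fix w assume "w \<in> cball s r"
      then show "w \<in> half_plane 0" using Re[of w] s \<alpha> by (simp add: half_plane_def r_def)
    qed
    have "norm ((deriv ^^ 1) (\<lambda>s. dirichlet_fun a s - a 1) s) \<le> fact 1 * (B * 2 powr (r - Re s)) / r ^ 1"
    proof (rule Cauchy_inequality)
      show "(\<lambda>s. dirichlet_fun a s - a 1) holomorphic_on ball s r"
        using sub by (intro holomorphic_on_subset[OF hol]) auto
      show "continuous_on (cball s r) (\<lambda>s. dirichlet_fun a s - a 1)"
        by (intro continuous_on_subset[OF holomorphic_on_imp_continuous_on[OF hol]] sub)
      fix w assume "norm (s - w) = r"
      then have w: "Re w \<ge> Re s - r" by (intro Re) (simp add: dist_norm)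
      then have "norm (dirichlet_fun a w - a 1) \<le> B * 2 powr (- Re w)" using s by (intro B) (simp add: r_def)
      also have "\<dots> \<le> B * 2 powr (r - Re s)" using w B by (intro mult_left_mono powr_mono) auto
      finally show "norm (dirichlet_fun a w - a 1) \<le> B * 2 powr (r - Re s)" .
    qed (use r in auto)
    moreover have "deriv (\<lambda>s. dirichlet_fun a s - a 1) s = deriv (dirichlet_fun a) s"
      using s \<alpha> dirichlet_holomorphic[OF a] open_half_plane[of 0]
      by (subst deriv_diff) (auto simp: half_plane_def intro: holomorphic_on_imp_differentiable_at)
    moreover have "2 powr (r - Re s) = 2 powr r * 2 powr (- Re s)" by (simp flip: powr_add)
    ultimately show ?thesis by (simp add: mult.assoc)
  qed
  define C where "C = max B (B * 2 powr r / r)"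
  have conv: "C * 2 powr (- x) = (C * 2 powr (- \<alpha>)) * exp (- ln 2 * (x - \<alpha>))" for x
    by (simp add: powr_def algebra_simps flip: exp_add)
  have "norm (dirichlet_fun a s - a 1) \<le> C * 2 powr (- Re s) \<and> norm (deriv (dirichlet_fun a) s) \<le> C * 2 powr (- Re s)"
    if "Re s \<ge> \<alpha>" for s
    by (intro conjI order_trans[OF B1[OF that]] order_trans[OF B2[OF that]] mult_right_mono)
       (auto simp: C_def)
  then show ?thesis
    unfolding conv[of "Re _"] by blast
qed

text \<open>
  On a vertical line \<open>n powr - s\<close> is a multiple of the character with frequency \<open>- ln n\<close>.
\<close>
lemma almost_periodic_dirichlet:
  assumes a: "abscissa_unif a \<le> 0" and \<sigma>: "\<sigma> > 0"
  shows "almost_periodic (\<lambda>t. dirichlet_fun a (Complex \<sigma> t))"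
proof (rule almost_periodic.limit)
  show "uniform_limit UNIV (\<lambda>N t. dirichlet_partial_sum a N (Complex \<sigma> t)) (\<lambda>t. dirichlet_fun a (Complex \<sigma> t)) sequentially"
    by (rule uniform_limit_compose'[OF uniform_limit_dirichlet[OF a, of "\<sigma>/2"]])
       (use \<sigma> in \<open>auto simp: half_plane_def\<close>)
  fix N
  have "almost_periodic (\<lambda>t. a n * of_nat n powr (- Complex \<sigma> t))" if "n \<in> {1..N}" for n
  proof -
    have "a n * of_nat n powr (- Complex \<sigma> t) =
        (a n * exp (of_real (- \<sigma> * ln (real n)))) * exp (\<i> * of_real ((- ln (real n)) * t))" for t
    proof -
      have "Ln (of_nat n) = of_real (ln (real n))" using that by (simp add: Ln_of_nat)
      then show ?thesis using that
        by (simp add: powr_def Complex_eq algebra_simps flip: exp_add exp_of_real)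
    qed
    then show ?thesis by (simp only: almost_periodic.character)
  qed
  then show "almost_periodic (\<lambda>t. dirichlet_partial_sum a N (Complex \<sigma> t))"
    unfolding dirichlet_partial_sum_def by (rule almost_periodic_sum)
qed

lemma dirichlet_countable_zeros:
  assumes a: "abscissa_unif a \<le> 0" and nz: "\<exists>s\<in>half_plane 0. dirichlet_fun a s \<noteq> 0"
  shows "countable {s \<in> half_plane 0. dirichlet_fun a s = 0}"
proof (cases "dirichlet_fun a constant_on half_plane 0")
  case True
  then have "{s \<in> half_plane 0. dirichlet_fun a s = 0} = {}" using nz by (auto simp: constant_on_def)
  then show ?thesis by (simp only: countable_empty)
next
  case False
  have conn: "connected (half_plane 0)"
    unfolding half_plane_def by (intro convex_connected convex_halfspace_Re_gt)
  have eq: "half_plane 0 = (\<Union>n. {s. inverse (real (Suc n)) \<le> Re s})"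
  proof (intro equalityI subsetI)
    fix s assume "s \<in> half_plane 0"
    then obtain n where "inverse (real (Suc n)) < Re s"
      using reals_Archimedean[of "Re s"] unfolding half_plane_def by blast
    then have "s \<in> {s. inverse (real (Suc n)) \<le> Re s}" by simp
    then show "s \<in> (\<Union>n. {s. inverse (real (Suc n)) \<le> Re s})" by blast
  next
    fix s assume "s \<in> (\<Union>n. {s. inverse (real (Suc n)) \<le> Re s})"
    then obtain n where "inverse (real (Suc n)) \<le> Re s" by blast
    moreover have "0 < inverse (real (Suc n))" by simp
    ultimately have "0 < Re s" by (rule less_le_trans[rotated])
    then show "s \<in> half_plane 0" by (simp add: half_plane_def)
  qed
  have "fsigma (half_plane 0)"
    unfolding eq by (rule fsigma.intros) (rule closed_halfspace_Re_ge)
  from holomorphic_countable_zeros[OF dirichlet_holomorphic[OF a] open_half_plane conn this False]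
  show ?thesis .
qed

section \<open>The Jensen formula on vertical lines and at the boundary\<close>

lemma lp_integral_antimono:
  assumes "\<sigma> \<le> \<tau>"
  shows "lp_integral f \<tau> T \<le> lp_integral f \<sigma> T"
  unfolding lp_integral_def
proof (rule nn_integral_mono)
  fix x :: real
  have "lp_density f s \<ge> 0" for s unfolding lp_density_def by simp
  then have "(\<integral>\<^sup>+t\<in>{-T..T}. ennreal (lp_density f (Complex x t) * (x - \<tau>)) \<partial>lborel)
      \<le> (\<integral>\<^sup>+t\<in>{-T..T}. ennreal (lp_density f (Complex x t) * (x - \<sigma>)) \<partial>lborel)"
    using assms by (intro nn_integral_mono mult_right_mono ennreal_leI mult_left_mono) auto
  then show "(\<integral>\<^sup>+t\<in>{-T..T}. ennreal (lp_density f (Complex x t) * (x - \<tau>)) \<partial>lborel) * indicator {\<tau><..} x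
      \<le> (\<integral>\<^sup>+t\<in>{-T..T}. ennreal (lp_density f (Complex x t) * (x - \<sigma>)) \<partial>lborel) * indicator {\<sigma><..} x"
    using assms by (auto simp: indicator_def)
qed

lemma continuous_on_ln_one_plus_norm: "continuous_on UNIV (\<lambda>z :: complex. ln (1 + norm z))"
proof -
  have "1 + norm z \<noteq> 0" for z :: complex using norm_ge_zero[of z] by linarith
  then show ?thesis by (intro continuous_intros) auto
qed

text \<open>
  This form makes the continuity at \<open>0\<close> visible, where \<open>ln\<close> itself is discontinuous.
\<close>
lemma log_plus_eq_ln_max: "x \<ge> 0 \<Longrightarrow> log_plus x = ln (max x 1)"
  by (cases "x = 0"; cases "x \<ge> 1") (auto simp: log_plus_def max_def ln_ge_zero not_le intro!: antisym)

lemma continuous_on_log_plus_norm: "continuous_on UNIV (\<lambda>z :: complex. log_plus (norm z))"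
proof -
  have "continuous_on UNIV (\<lambda>z :: complex. ln (max (norm z) 1))"
    by (intro continuous_intros) (auto simp: max_def)
  then show ?thesis by (simp add: log_plus_eq_ln_max)
qed

lemma ln_one_plus_le_log_plus: 
  assumes "x \<ge> 0"
  shows "ln (1 + x) \<le> ln 2 + log_plus x"
proof -
  have "ln (1 + x) \<le> ln (2 * max x 1)" using assms by (subst ln_le_cancel_iff) auto
  also have "\<dots> = ln 2 + log_plus x" using assms by (subst ln_mult_pos) (auto simp: log_plus_eq_ln_max)
  finally show ?thesis .
qed

definition log_mean :: "(nat \<Rightarrow> complex) \<Rightarrow> real \<Rightarrow> real" where
  "log_mean a \<sigma> = mean_value (\<lambda>t. ln (1 + norm (dirichlet_fun a (Complex \<sigma> t))))"

lemma log_mean_tendsto: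
  assumes "abscissa_unif a \<le> 0" "\<sigma> > 0"
  shows "((\<lambda>T. 1 / (2 * T) * integral {-T..T} (\<lambda>t. ln (1 + norm (dirichlet_fun a (Complex \<sigma> t))))) \<longlongrightarrow> log_mean a \<sigma>) at_top"
  unfolding log_mean_def
  by (rule mean_value_tendsto[OF almost_periodic_dirichlet[OF assms] continuous_on_ln_one_plus_norm])

lemma continuous_on_dirichlet_vertical:
  assumes "abscissa_unif a \<le> 0" "\<sigma> > 0" "continuous_on UNIV \<phi>"
  shows "continuous_on A (\<lambda>t. \<phi> (dirichlet_fun a (Complex \<sigma> t)))"
  by (rule continuous_on_compose2[OF assms(3) continuous_on_subset[OF almost_periodic_continuous[OF almost_periodic_dirichlet[OF assms(1,2)]]]])
     simp_all

lemma log_mean_le: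
  assumes a: "abscissa_unif a \<le> 0" and \<sigma>: "\<sigma> > 0"
  shows "log_mean a \<sigma> \<le> ln 2 + mean_value (\<lambda>t. log_plus (norm (dirichlet_fun a (Complex \<sigma> t))))"
proof (rule tendsto_le[OF _ _ log_mean_tendsto[OF a \<sigma>]])
  let ?p = "\<lambda>t. log_plus (norm (dirichlet_fun a (Complex \<sigma> t)))"
  show "((\<lambda>T. ln 2 + 1 / (2 * T) * integral {-T..T} ?p) \<longlongrightarrow> ln 2 + mean_value ?p) at_top"
    by (intro tendsto_intros mean_value_tendsto[OF almost_periodic_dirichlet[OF a \<sigma>] continuous_on_log_plus_norm])
  show "\<forall>\<^sub>F T in at_top. 1 / (2 * T) * integral {-T..T} (\<lambda>t. ln (1 + norm (dirichlet_fun a (Complex \<sigma> t))))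
      \<le> ln 2 + 1 / (2 * T) * integral {-T..T} ?p"
    using eventually_gt_at_top[of "0::real"]
  proof eventually_elim
    case (elim T)
    have int: "(\<lambda>t. ln (1 + norm (dirichlet_fun a (Complex \<sigma> t)))) integrable_on {-T..T}"
      "?p integrable_on {-T..T}"
      by (intro integrable_continuous_real continuous_on_dirichlet_vertical[OF a \<sigma>]
           continuous_on_ln_one_plus_norm continuous_on_log_plus_norm)+
    have "integral {-T..T} (\<lambda>t. ln (1 + norm (dirichlet_fun a (Complex \<sigma> t)))) \<le> integral {-T..T} (\<lambda>t. ln 2 + ?p t)"
      by (intro integral_le int integrable_add integrable_const_ivl ln_one_plus_le_log_plus) auto
    also have "\<dots> = 2 * T * ln 2 + integral {-T..T} ?p"
      using elim by (subst integral_add) (auto intro: int)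
    finally have "1 / (2 * T) * integral {-T..T} (\<lambda>t. ln (1 + norm (dirichlet_fun a (Complex \<sigma> t))))
       \<le> 1 / (2 * T) * (2 * T * ln 2 + integral {-T..T} ?p)"
      using elim by (intro mult_left_mono) auto
    also have "\<dots> = ln 2 + 1 / (2 * T) * integral {-T..T} ?p" using elim by (simp add: field_simps)
    finally show ?case .
  qed
qed simp

text \<open>
  In \<open>lp_integral_estimate\<close> the error is bounded in \<open>T\<close>, so it vanishes after division
  by \<open>2 T\<close>. The inequality expresses that the area integrals are nonnegative.
\<close>
lemma jensen_formula_vertical_line:
  assumes a: "abscissa_unif a \<le> 0" and nz: "\<exists>s\<in>half_plane 0. dirichlet_fun a s \<noteq> 0" and \<sigma>: "\<sigma> > 0"
  shows "ln (1 + norm (a 1)) \<le> log_mean a \<sigma>"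
    and "((\<lambda>T. ennreal (1 / (2 * T)) * lp_integral (dirichlet_fun a) \<sigma> T) \<longlongrightarrow>
       ennreal (log_mean a \<sigma> - ln (1 + norm (a 1)))) at_top"
proof -
  define c where "c = ln (1 + norm (a 1))"
  define u where "u t = ln (1 + norm (dirichlet_fun a (Complex \<sigma> t)))" for t
  obtain B where B: "\<And>s. Re s \<ge> \<sigma> \<Longrightarrow> norm (dirichlet_fun a s - a 1) \<le> B * exp (- ln 2 * (Re s - \<sigma>))"
     "\<And>s. Re s \<ge> \<sigma> \<Longrightarrow> norm (deriv (dirichlet_fun a) s) \<le> B * exp (- ln 2 * (Re s - \<sigma>))"
    using dirichlet_decay_deriv[OF a \<sigma>] by blast
  define K where "K = 2 * B / (ln 2)\<^sup>2"
  have "\<exists>R\<ge>0. lp_integral (dirichlet_fun a) \<sigma> T = ennreal R \<and> \<bar>R - integral {-T..T} (\<lambda>t. u t - c)\<bar> \<le> K" if "T > 0" for T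
    unfolding u_def c_def K_def
    by (rule lp_integral_estimate[OF dirichlet_holomorphic[OF a] \<sigma> _ that B dirichlet_countable_zeros[OF a nz]]) simp
  then obtain R where R: "\<And>T. T > 0 \<Longrightarrow> R T \<ge> 0" "\<And>T. T > 0 \<Longrightarrow> lp_integral (dirichlet_fun a) \<sigma> T = ennreal (R T)"
     "\<And>T. T > 0 \<Longrightarrow> \<bar>R T - integral {-T..T} (\<lambda>t. u t - c)\<bar> \<le> K"
    by metis
  have pos: "\<forall>\<^sub>F T in at_top. (T :: real) > 0" by (rule eventually_gt_at_top)
  have "((\<lambda>T. 1 / (2 * T) * R T - (1 / (2 * T) * integral {-T..T} u - c)) \<longlongrightarrow> 0) at_top"
  proof (rule Lim_null_comparison)
    have "((\<lambda>T. K / 2 * inverse T) \<longlongrightarrow> K / 2 * 0) at_top"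
      by (intro tendsto_intros tendsto_inverse_0_at_top filterlim_ident)
    then show "((\<lambda>T. K / 2 * inverse T) \<longlongrightarrow> 0) at_top" by simp
    show "\<forall>\<^sub>F T in at_top. norm (1 / (2 * T) * R T - (1 / (2 * T) * integral {-T..T} u - c)) \<le> K / 2 * inverse T"
      using pos
    proof eventually_elim
      case (elim T)
      have "u integrable_on {-T..T}" unfolding u_def
        by (intro integrable_continuous_real continuous_on_dirichlet_vertical[OF a \<sigma>] continuous_on_ln_one_plus_norm)
      then have "integral {-T..T} (\<lambda>t. u t - c) = integral {-T..T} u - 2 * T * c"
        using elim by (subst integral_diff) auto
      then have "1 / (2 * T) * R T - (1 / (2 * T) * integral {-T..T} u - c) =
          1 / (2 * T) * (R T - integral {-T..T} (\<lambda>t. u t - c))"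
        using elim by (simp add: field_simps)
      also have "norm \<dots> \<le> 1 / (2 * T) * K"
        unfolding norm_mult using R(3)[OF elim] elim by (intro mult_mono) auto
      also have "\<dots> = K / 2 * inverse T" by (simp add: field_simps)
      finally show ?case .
    qed
  qed
  moreover have "((\<lambda>T. 1 / (2 * T) * integral {-T..T} u - c) \<longlongrightarrow> log_mean a \<sigma> - c) at_top"
    unfolding u_def by (intro tendsto_diff log_mean_tendsto a \<sigma> tendsto_const)
  ultimately have lim: "((\<lambda>T. 1 / (2 * T) * R T) \<longlongrightarrow> log_mean a \<sigma> - c) at_top"
    by (rule Lim_transform[rotated])
  have "0 \<le> log_mean a \<sigma> - c"
    by (rule tendsto_lowerbound[OF lim eventually_mono[OF pos]]) (simp_all add: R(1))
  then show "ln (1 + norm (a 1)) \<le> log_mean a \<sigma>" by (simp add: c_def)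
  have "\<forall>\<^sub>F T in at_top. ennreal (1 / (2 * T) * R T) = ennreal (1 / (2 * T)) * lp_integral (dirichlet_fun a) \<sigma> T"
    using pos
  proof eventually_elim
    case (elim T)
    then show ?case using R(1)[OF elim] unfolding R(2)[OF elim] by (intro ennreal_mult) auto
  qed
  then show "((\<lambda>T. ennreal (1 / (2 * T)) * lp_integral (dirichlet_fun a) \<sigma> T) \<longlongrightarrow>
       ennreal (log_mean a \<sigma> - ln (1 + norm (a 1)))) at_top"
    unfolding c_def[symmetric] by (rule Lim_transform_eventually[OF tendsto_ennrealI[OF lim]])
qed

text \<open>
  By the Jensen formula \<open>log_mean\<close> is, up to a constant, a limit of the area integrals, whose
  domain and weight \<open>\<sigma> - \<sigma>\<^sub>0\<close> both shrink as \<open>\<sigma>\<^sub>0\<close> grows.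
\<close>
lemma log_mean_antimono:
  assumes a: "abscissa_unif a \<le> 0" and nz: "\<exists>s\<in>half_plane 0. dirichlet_fun a s \<noteq> 0"
    and "0 < \<sigma>" "\<sigma> \<le> \<tau>"
  shows "log_mean a \<tau> \<le> log_mean a \<sigma>"
proof -
  have \<tau>: "\<tau> > 0" using assms by simp
  have "ennreal (log_mean a \<tau> - ln (1 + norm (a 1))) \<le> ennreal (log_mean a \<sigma> - ln (1 + norm (a 1)))"
    by (rule tendsto_le[OF _ jensen_formula_vertical_line(2)[OF a nz \<open>0 < \<sigma>\<close>] jensen_formula_vertical_line(2)[OF a nz \<tau>]])
       (simp_all add: always_eventually mult_left_mono lp_integral_antimono[OF \<open>\<sigma> \<le> \<tau>\<close>])
  then show ?thesis using jensen_formula_vertical_line(1)[OF a nz \<open>0 < \<sigma>\<close>] by (subst (asm) ennreal_le_iff) auto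
qed

lemma antimono_tendsto_at_right:
  fixes M :: "real \<Rightarrow> real"
  assumes mono: "\<And>\<sigma> \<tau>. x < \<sigma> \<Longrightarrow> \<sigma> \<le> \<tau> \<Longrightarrow> M \<tau> \<le> M \<sigma>" and bdd: "bdd_above (M ` {x<..})"
  shows "(M \<longlongrightarrow> (SUP \<sigma>\<in>{x<..}. M \<sigma>)) (at_right x)"
proof (rule order_tendstoI)
  fix y assume "y < (SUP \<sigma>\<in>{x<..}. M \<sigma>)"
  then obtain \<tau> where \<tau>: "\<tau> > x" "y < M \<tau>" using bdd by (subst (asm) less_cSUP_iff) auto
  have "\<forall>\<^sub>F \<sigma> in at_right x. \<sigma> \<in> {x<..<\<tau>}" using \<tau>(1) by (rule eventually_at_right_real)
  then show "\<forall>\<^sub>F \<sigma> in at_right x. y < M \<sigma>"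
  proof eventually_elim
    case (elim \<sigma>)
    then show ?case using mono[of \<sigma> \<tau>] \<tau> by auto
  qed
next
  fix y assume y: "(SUP \<sigma>\<in>{x<..}. M \<sigma>) < y"
  show "\<forall>\<^sub>F \<sigma> in at_right x. M \<sigma> < y"
    using eventually_at_right_less[of x]
  proof eventually_elim
    case (elim \<sigma>)
    then have "M \<sigma> \<le> (SUP \<sigma>\<in>{x<..}. M \<sigma>)" by (intro cSUP_upper bdd) auto
    then show ?case using y by simp
  qed
qed

text \<open>
  The class condition bounds the means only near the boundary; monotonicity extends the bound
  to all vertical lines.
\<close>
lemma log_mean_bounded:
  assumes "a \<in> nevanlinna_class" and nz: "\<exists>s\<in>half_plane 0. dirichlet_fun a s \<noteq> 0"
  shows "bdd_above (log_mean a ` {0<..})"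
proof -
  have a: "abscissa_unif a \<le> 0" using assms by (simp add: nevanlinna_class_def)
  let ?P = "\<lambda>\<sigma>. mean_value (\<lambda>t. log_plus (norm (dirichlet_fun a (Complex \<sigma> t))))"
  have "Limsup (at_right 0) (\<lambda>\<sigma>. ereal (?P \<sigma>)) < \<infinity>"
    using assms by (simp add: nevanlinna_class_def)
  then obtain K where "Limsup (at_right 0) (\<lambda>\<sigma>. ereal (?P \<sigma>)) < ereal K"
    by (auto dest: less_PInf_Ex_of_nat[THEN iffD1])
  then have "\<forall>\<^sub>F \<sigma> in at_right 0. ereal (?P \<sigma>) < ereal K" by (rule Limsup_lessD)
  then obtain \<delta> where \<delta>: "\<delta> > 0" "\<And>\<sigma>. 0 < \<sigma> \<Longrightarrow> \<sigma> < \<delta> \<Longrightarrow> ?P \<sigma> < K"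
    by (auto simp: eventually_at_right_field)
  have "log_mean a \<sigma> \<le> ln 2 + K" if "\<sigma> > 0" for \<sigma>
  proof -
    have m: "min \<sigma> (\<delta>/2) > 0" "min \<sigma> (\<delta>/2) < \<delta>" using that \<delta>(1) by auto
    have "log_mean a \<sigma> \<le> log_mean a (min \<sigma> (\<delta>/2))" by (rule log_mean_antimono[OF a nz m(1)]) simp
    also have "\<dots> \<le> ln 2 + K" using log_mean_le[OF a m(1)] \<delta>(2)[OF m] by simp
    finally show ?thesis .
  qed
  then show ?thesis by (intro bdd_aboveI2[of _ _ "ln 2 + K"]) simp
qed

theorem theorem1p1:
  fixes a :: "nat \<Rightarrow> complex"
  assumes "a \<in> nevanlinna_class"
    and "\<exists>s\<in>half_plane 0. dirichlet_fun a s \<noteq> 0"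
  shows "\<exists>(J :: real \<Rightarrow> ennreal) (L :: real). 0 \<le> L \<and>
           (\<forall>\<sigma>\<^sub>0>0. ((\<lambda>T. ennreal (1 / (2 * T)) * lp_integral (dirichlet_fun a) \<sigma>\<^sub>0 T) \<longlongrightarrow> J \<sigma>\<^sub>0) at_top) \<and>
           (J \<longlongrightarrow> ennreal L) (at_right 0) \<and>
           nevanlinna_norm a = ereal (ln (1 + norm (a 1)) + L)"
proof -
  have a: "abscissa_unif a \<le> 0" using assms(1) by (simp add: nevanlinna_class_def)
  define c where "c = ln (1 + norm (a 1))"
  define S where "S = (SUP \<sigma>\<in>{0<..}. log_mean a \<sigma>)"
  have lim: "(log_mean a \<longlongrightarrow> S) (at_right 0)"
    unfolding S_def using log_mean_antimono[OF a assms(2)] log_mean_bounded[OF assms]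
    by (rule antimono_tendsto_at_right)
  have "c \<le> log_mean a 1" unfolding c_def by (rule jensen_formula_vertical_line(1)[OF a assms(2)]) simp
  also have "\<dots> \<le> S" unfolding S_def by (intro cSUP_upper log_mean_bounded assms) simp
  finally have nonneg: "0 \<le> S - c" by simp
  have J: "\<forall>\<sigma>>0. ((\<lambda>T. ennreal (1 / (2 * T)) * lp_integral (dirichlet_fun a) \<sigma> T)
      \<longlongrightarrow> ennreal (log_mean a \<sigma> - c)) at_top"
    unfolding c_def using jensen_formula_vertical_line(2)[OF a assms(2)] by blast
  have L: "((\<lambda>\<sigma>. ennreal (log_mean a \<sigma> - c)) \<longlongrightarrow> ennreal (S - c)) (at_right 0)"
    by (intro tendsto_ennrealI tendsto_diff lim tendsto_const)
  have norm: "nevanlinna_norm a = ereal (c + (S - c))"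
    unfolding nevanlinna_norm_def log_mean_def[symmetric]
    using lim_imp_Limsup[OF trivial_limit_at_right_real tendsto_ereal[OF lim]] by simp
  show ?thesis
    unfolding c_def[symmetric]
    by (rule exI[of _ "\<lambda>\<sigma>. ennreal (log_mean a \<sigma> - c)"], rule exI[of _ "S - c"])
       (intro conjI nonneg J L norm)
qed

end
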